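(* Let $k$ be a field, let $d\ge 1$ be an integer, and let $G=([n],E)$ be a graph. Then: (1) If $L_G^{k}(d)$ is prime (resp. a complete intersection), then $L_G^{k}(d+1)$ is prime (resp. a complete intersection). (2) If $L_G^{k}(d)$ is prime (resp. a complete intersection), then $L_{G'}^{k}(d)$ is prime (resp. a complete intersection) for every subgraph $G'$ of $G$.
   Context: Graphs are finite simple graphs; $[n]=\{1,\dots,n\}$. A subgraph of $G=(V,E)$ is a graph $G'=(V',E')$ with $V'\subseteq V$ and $E'\subseteq E$. For a graph $G=(V,E)$, a field $k$ and an integer $d\ge 1$, let $S=k[y_{i,\ell} : i\in V,\ \ell\in[d]]$, and for every edge $e=\{i,j\}\in E$ put $f_e^{(d)}=\sum_{\ell=1}^d y_{i,\ell}\,y_{j,\ell}$. The Lovász–Saks–Schrijver ideal is $L_G^{k}(d)=(f_e^{(d)} : e\in E)\subseteq S$. An ideal is a complete intersection if it is generated by a regular sequence (the zero ideal counts); for $L_G^k(d)$ this is equivalent to the generators $f_e^{(d)}$, $e\in E$, forming a regular sequence in $S$. *)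

theory Defs
  imports "HOL-Library.Poly_Mapping" "HOL-Algebra.Ideal"
begin

definition simple_graph :: "'v set \<Rightarrow> 'v set set \<Rightarrow> bool" where
  "simple_graph V E \<longleftrightarrow> finite V \<and> (\<forall>e\<in>E. e \<subseteq> V \<and> card e = 2)"

definition subgraph :: "'v set \<Rightarrow> 'v set set \<Rightarrow> 'v set \<Rightarrow> 'v set set \<Rightarrow> bool" where
  "subgraph V' E' V E \<longleftrightarrow> simple_graph V' E' \<and> V' \<subseteq> V \<and> E' \<subseteq> E"

text \<open>
  A polynomial is a finitely supported coefficient function on monomials, and a monomial is a
  finitely supported exponent function on variables. The ring \<open>k[X]\<close> is the subring of those
  polynomials whose monomials involve only variables in \<open>X\<close>; the carrier has to be explicit,
  because a subgraph with fewer vertices has its ideal in a smaller polynomial ring.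
\<close>

type_synonym ('x, 'k) mpoly = "('x \<Rightarrow>\<^sub>0 nat) \<Rightarrow>\<^sub>0 'k"

definition mpoly_ring :: "'x set \<Rightarrow> ('x, 'k::comm_ring_1) mpoly ring" where
  "mpoly_ring X = \<lparr>carrier = {p. \<forall>m \<in> Poly_Mapping.keys p. Poly_Mapping.keys m \<subseteq> X},
     mult = (*), one = 1, zero = 0, add = (+)\<rparr>"

definition mvar :: "'x \<Rightarrow> ('x, 'k::comm_ring_1) mpoly" where
  "mvar x = Poly_Mapping.single (Poly_Mapping.single x 1) 1"

text \<open>
  The argument of type \<open>'k itself\<close> names the coefficient field. The variable \<open>y\<^sub>i\<^sub>,\<^sub>l\<close> is
  \<open>mvar (i, l)\<close>. Since \<open>lss_poly d i j = lss_poly d j i\<close>, every edge contributes exactly one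
  generator.
\<close>

definition lss_ring :: "'k::field itself \<Rightarrow> nat \<Rightarrow> 'v set \<Rightarrow> ('v \<times> nat, 'k) mpoly ring" where
  "lss_ring k d V = mpoly_ring (V \<times> {1..d})"

definition lss_poly :: "nat \<Rightarrow> 'v \<Rightarrow> 'v \<Rightarrow> ('v \<times> nat, 'k::field) mpoly" where
  "lss_poly d i j = (\<Sum>l = 1..d. mvar (i, l) * mvar (j, l))"

definition lss_ideal ::
    "'k::field itself \<Rightarrow> nat \<Rightarrow> 'v set \<Rightarrow> 'v set set \<Rightarrow> ('v \<times> nat, 'k) mpoly set" where
  "lss_ideal k d V E = Idl\<^bsub>lss_ring k d V\<^esub> {lss_poly d i j | i j. {i, j} \<in> E}"

text \<open>
  The second conjunct says that the \<open>i\<close>-th element is a non-zero-divisor on the quotient by the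
  ideal generated by its predecessors.
\<close>

definition regular_sequence :: "('a, 'b) ring_scheme \<Rightarrow> 'a list \<Rightarrow> bool" where
  "regular_sequence R rs \<longleftrightarrow>
     set rs \<subseteq> carrier R \<and>
     (\<forall>i < length rs. \<forall>a \<in> carrier R.
        rs ! i \<otimes>\<^bsub>R\<^esub> a \<in> Idl\<^bsub>R\<^esub> (set (take i rs)) \<longrightarrow> a \<in> Idl\<^bsub>R\<^esub> (set (take i rs))) \<and>
     Idl\<^bsub>R\<^esub> (set rs) \<noteq> carrier R"

text \<open>The empty sequence is regular in a nonzero ring, so the zero ideal is included.\<close>

definition complete_intersection :: "'a set \<Rightarrow> ('a, 'b) ring_scheme \<Rightarrow> bool" where
  "complete_intersection I R \<longleftrightarrow> (\<exists>rs. regular_sequence R rs \<and> I = Idl\<^bsub>R\<^esub> (set rs))"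

lemma cring_mpoly_ring: "cring (mpoly_ring X :: ('x, 'k::comm_ring_1) mpoly ring)"
proof (rule cringI)
  show "abelian_group (mpoly_ring X :: ('x, 'k) mpoly ring)"
  proof (rule abelian_groupI)
    fix p :: "('x, 'k) mpoly"
    assume "p \<in> carrier (mpoly_ring X)"
    then show "\<exists>q\<in>carrier (mpoly_ring X). q \<oplus>\<^bsub>mpoly_ring X\<^esub> p = \<zero>\<^bsub>mpoly_ring X\<^esub>"
      by (intro bexI [of _ "- p"]) (auto simp: mpoly_ring_def in_keys_iff)
  qed (auto simp: mpoly_ring_def algebra_simps dest: Poly_Mapping.keys_add [THEN subsetD])
next
  show "Group.comm_monoid (mpoly_ring X :: ('x, 'k) mpoly ring)"
  proof (rule comm_monoidI)
    fix p q :: "('x, 'k) mpoly"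
    assume p: "p \<in> carrier (mpoly_ring X)" and q: "q \<in> carrier (mpoly_ring X)"
    have "Poly_Mapping.keys m \<subseteq> X" if "m \<in> Poly_Mapping.keys (p * q)" for m
    proof -
      from that obtain a b where "m = a + b" "a \<in> Poly_Mapping.keys p" "b \<in> Poly_Mapping.keys q"
        using keys_mult by blast
      with p q show ?thesis
        using Poly_Mapping.keys_add [of a b] by (fastforce simp: mpoly_ring_def)
    qed
    then show "p \<otimes>\<^bsub>mpoly_ring X\<^esub> q \<in> carrier (mpoly_ring X)"
      by (simp add: mpoly_ring_def)
  qed (auto simp: mpoly_ring_def algebra_simps)
qed (auto simp: mpoly_ring_def algebra_simps)

lemma lss_poly_in_carrier:
  assumes "i \<in> V" "j \<in> V"
  shows "lss_poly d i j \<in> carrier (lss_ring k d V)"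
proof -
  interpret R: cring "lss_ring k d V"
    unfolding lss_ring_def by (rule cring_mpoly_ring)
  have var: "mvar (v, l) \<in> carrier (lss_ring k d V)" if "v \<in> V" "l \<in> {1..d}" for v l
    using that by (auto simp: lss_ring_def mpoly_ring_def mvar_def)
  have "(\<Sum>l\<in>A. mvar (i, l) * mvar (j, l)) \<in> carrier (lss_ring k d V)"
    if "finite A" "A \<subseteq> {1..d}" for A
    using that
  proof (induction A)
    case empty
    show ?case by (simp add: lss_ring_def mpoly_ring_def)
  next
    case (insert l A)
    have "mvar (i, l) * mvar (j, l) \<in> carrier (lss_ring k d V)"
      using R.m_closed [OF var var, of i l j l] insert.prems assms
      by (simp add: lss_ring_def mpoly_ring_def)
    with insert show ?case
      using R.a_closed [of "mvar (i, l) * mvar (j, l)" "\<Sum>l\<in>A. mvar (i, l) * mvar (j, l)"]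
      by (simp add: lss_ring_def mpoly_ring_def)
  qed
  then show ?thesis
    by (simp add: lss_poly_def)
qed

end

theory Submission
  imports Defs "HOL-Computational_Algebra.Polynomial"
begin

text \<open>
  The proof works with gradings and syzygies inside the polynomial ring. The edge
  polynomials are quadrics, so ideals generated by them are graded, and statements about such ideals
  may be proved modulo polynomials of arbitrarily high degree: the truncation of a polynomial at a
  given degree maps the ideal into itself (\<open>gen_ideal_separated\<close>, \<open>koszul_if_approximable\<close>).

  Complete intersections are handled through the first Koszul homology. Call a family
  \<open>koszul_acyclic\<close> if each of its syzygies is a combination of the trivial ones
  \<open>f\<^sub>j e\<^sub>i - f\<^sub>i e\<^sub>j\<close>. A regular sequence has this property, and a family of quadrics with this
  property is a regular sequence in every order; in contrast to regularity, the property
  does not mention an order, passes to subfamilies of quadrics (\<open>koszul_acyclic_subset\<close>), and passes from one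
  system of generators of an ideal to every minimal system of quadrics generating it
  (\<open>koszul_acyclic_change_generators\<close>). As the edge polynomials are linearly independent, the ideal
  of a graph is a complete intersection if and only if its edge polynomials are Koszul acyclic.
  Inheritance by subgraphs is then immediate.

  Increasing \<open>d\<close> adds the variables \<open>y\<^sub>v\<^sub>,\<^sub>d\<^sub>+\<^sub>1\<close>. Adding them one vertex at a time, each step is a
  family of quadrics that specialises to the previous one when the new variable is set to zero. Both
  Koszul acyclicity and, in its presence, primality lift along such a specialisation
  (\<open>koszul_acyclic_lift\<close>, \<open>prime_in_lift\<close>).

  It remains to see that a prime ideal \<open>P\<close> of a graph stays prime when an edge \<open>e = {v, j}\<close> is removed, and that
  \<open>f\<^sub>e\<close> is a nonzerodivisor modulo the ideal \<open>Q\<close> of the other edges (\<open>remove_edge\<close>); the edge polynomials are then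
  Koszul acyclic by induction. Primality bounds the degree of \<open>v\<close> by \<open>d - 1\<close>, so there is a
  polynomial vector \<open>w\<close> orthogonal to the vectors of all neighbours of \<open>v\<close> except \<open>j\<close>, with
  \<open>s = \<langle>y\<^sub>j, w\<rangle>\<close> outside \<open>P\<close>. The substitution \<open>y\<^sub>v \<mapsto> y\<^sub>v + t w\<close> preserves \<open>Q\<close> and sends \<open>f\<^sub>e\<close> to
  \<open>f\<^sub>e + s t\<close>, whose leading coefficient in \<open>t\<close> is \<open>s\<close>. Comparing coefficients shows that \<open>f\<^sub>e\<close> is a
  nonzerodivisor modulo \<open>Q\<close> once \<open>s\<close> is inverted. Since \<open>s\<close> is not in the prime ideal \<open>P = Q + (f\<^sub>e)\<close>,
  a degree argument removes the localisation (\<open>nonzerodivisor_if_saturated\<close>), and then the ideal \<open>Q\<close>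
  is prime because \<open>Q + (f\<^sub>e)\<close> is (\<open>prime_in_if_prime_adjoin\<close>).
\<close>

section \<open>Polynomials and substitutions\<close>

locale unital_hom =
  fixes h :: "'a::comm_ring_1 \<Rightarrow> 'b::comm_ring_1"
  assumes hom_one: "h 1 = 1"
    and hom_add: "h (a + b) = h a + h b"
    and hom_mult: "h (a * b) = h a * h b"
begin

lemma hom_zero: "h 0 = 0"
  using hom_add [of 0 0] by simp

lemma hom_uminus: "h (- a) = - h a"
  using hom_add [of a "- a"] by (simp add: hom_zero add_eq_0_iff2)

lemma hom_diff: "h (a - b) = h a - h b"
  using hom_add [of a "- b"] by (simp add: hom_uminus)

lemma hom_sum: "h (\<Sum>i\<in>I. g i) = (\<Sum>i\<in>I. h (g i))"
  by (induction I rule: infinite_finite_induct) (simp_all add: hom_zero hom_add)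

lemma hom_prod: "h (\<Prod>i\<in>I. g i) = (\<Prod>i\<in>I. h (g i))"
  by (induction I rule: infinite_finite_induct) (simp_all add: hom_one hom_mult)

end

definition const :: "'k \<Rightarrow> ('x, 'k::comm_ring_1) mpoly" where
  "const c = Poly_Mapping.single 0 c"

definition polys :: "'x set \<Rightarrow> ('x, 'k::comm_ring_1) mpoly set" where
  "polys X = carrier (mpoly_ring X)"

lemma polys_iff: "p \<in> polys X \<longleftrightarrow> (\<forall>m\<in>Poly_Mapping.keys p. Poly_Mapping.keys m \<subseteq> X)"
  by (simp add: polys_def mpoly_ring_def)

lemma polys_zero [simp]: "0 \<in> polys X"
  and polys_one [simp]: "1 \<in> polys X"
  and polys_const [simp]: "const c \<in> polys X"
  by (simp_all add: polys_iff const_def)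

lemma polys_mvar [simp]: "x \<in> X \<Longrightarrow> mvar x \<in> polys X"
  by (simp add: polys_iff mvar_def)

lemma polys_uminus [simp]: "p \<in> polys X \<Longrightarrow> - p \<in> polys X"
  by (simp add: polys_iff in_keys_iff)

lemma polys_add [simp]: "p \<in> polys X \<Longrightarrow> q \<in> polys X \<Longrightarrow> p + q \<in> polys X"
  using Poly_Mapping.keys_add [of p q] by (auto simp: polys_iff)

lemma polys_diff [simp]: "p \<in> polys X \<Longrightarrow> q \<in> polys X \<Longrightarrow> p - q \<in> polys X"
  using polys_add [of p X "- q"] by simp

lemma polys_mult [simp]: "p \<in> polys X \<Longrightarrow> q \<in> polys X \<Longrightarrow> p * q \<in> polys X"
  using monoid.m_closed [of "mpoly_ring X" p q]
    cring.axioms(1) [OF cring_mpoly_ring] ring.is_monoid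
  by (auto simp: polys_def mpoly_ring_def)

lemma polys_sum [simp]: "(\<And>i. i \<in> I \<Longrightarrow> g i \<in> polys X) \<Longrightarrow> (\<Sum>i\<in>I. g i) \<in> polys X"
  by (induction I rule: infinite_finite_induct) simp_all

lemma polys_prod [simp]: "(\<And>i. i \<in> I \<Longrightarrow> g i \<in> polys X) \<Longrightarrow> (\<Prod>i\<in>I. g i) \<in> polys X"
  by (induction I rule: infinite_finite_induct) simp_all

lemma polys_power [simp]: "p \<in> polys X \<Longrightarrow> p ^ n \<in> polys X"
  by (induction n) simp_all

lemma polys_mono: "X \<subseteq> Y \<Longrightarrow> p \<in> polys X \<Longrightarrow> p \<in> polys Y"
  by (auto simp: polys_iff)

lemma const_zero [simp]: "const 0 = 0"
  and const_one [simp]: "const 1 = 1"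
  by (simp_all add: const_def)

lemma const_add: "const (a + b) = const a + const b"
  and const_mult: "const (a * b) = const a * const b"
  by (simp_all add: const_def single_add mult_single)

lemma poly_mapping_sum_single:
  "p = (\<Sum>m\<in>Poly_Mapping.keys p. Poly_Mapping.single m (Poly_Mapping.lookup p m))"
  by (rule poly_mapping_eqI)
     (auto simp: lookup_sum lookup_single when_def in_keys_iff sum.delta)

lemma single_eq_const_mult_mvars:
  "Poly_Mapping.single m c = const c * (\<Prod>x\<in>Poly_Mapping.keys m. mvar x ^ Poly_Mapping.lookup m x)"
    (is "_ = _ * ?M m")
proof -
  have pow: "mvar x ^ n = Poly_Mapping.single (Poly_Mapping.single x n) (1 :: 'b)" for x :: 'a and n
    by (induction n) (simp_all add: mvar_def mult_single flip: single_add)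
  have "(\<Prod>x\<in>F. mvar x ^ Poly_Mapping.lookup m x) =
      Poly_Mapping.single (\<Sum>x\<in>F. Poly_Mapping.single x (Poly_Mapping.lookup m x)) (1 :: 'b)"
    if "finite F" for F
    using that by (induction F) (simp_all add: pow mult_single)
  then have "?M m = Poly_Mapping.single m 1"
    using poly_mapping_sum_single [of m] by simp
  then show ?thesis
    by (simp add: const_def mult_single)
qed

lemma polys_induct [consumes 1, case_names const mvar add mult]:
  assumes "p \<in> polys X"
    and const: "\<And>c. P (const c)" and mvar: "\<And>x. x \<in> X \<Longrightarrow> P (mvar x)"
    and add: "\<And>p q. p \<in> polys X \<Longrightarrow> q \<in> polys X \<Longrightarrow> P p \<Longrightarrow> P q \<Longrightarrow> P (p + q)"
    and mult: "\<And>p q. p \<in> polys X \<Longrightarrow> q \<in> polys X \<Longrightarrow> P p \<Longrightarrow> P q \<Longrightarrow> P (p * q)"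
  shows "P p"
proof -
  let ?P = "\<lambda>p. p \<in> polys X \<and> P p"
  have zero: "?P 0" and one: "?P 1"
    using const [of 0] const [of 1] by auto
  have power: "?P (mvar x ^ n)" if "x \<in> X" for x n
    using that one mvar mult by (induction n) auto
  have prod: "?P (\<Prod>x\<in>F. mvar x ^ e x)" if "F \<subseteq> X" for F and e :: "'a \<Rightarrow> nat"
    using that power one mult by (induction F rule: infinite_finite_induct) auto
  have single: "?P (Poly_Mapping.single m c)" if "Poly_Mapping.keys m \<subseteq> X" for m c
    unfolding single_eq_const_mult_mvars using that prod const mult by auto
  have "?P (\<Sum>m\<in>F. Poly_Mapping.single m (Poly_Mapping.lookup p m))"
    if "F \<subseteq> Poly_Mapping.keys p" for F
    using that
  proof (induction F rule: infinite_finite_induct)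
    case (insert m F)
    moreover have "Poly_Mapping.keys m \<subseteq> X"
      using insert.prems assms(1) by (auto simp: polys_iff)
    ultimately show ?case
      using single [of m] add by simp
  qed (use zero in auto)
  then show ?thesis
    using poly_mapping_sum_single [of p] by fastforce
qed

definition subst_monom :: "('x \<Rightarrow> 'r::comm_ring_1) \<Rightarrow> ('x \<Rightarrow>\<^sub>0 nat) \<Rightarrow> 'r" where
  "subst_monom \<phi> m = (\<Prod>x\<in>Poly_Mapping.keys m. \<phi> x ^ Poly_Mapping.lookup m x)"

definition subst :: "('k \<Rightarrow> 'r) \<Rightarrow> ('x \<Rightarrow> 'r) \<Rightarrow> ('x, 'k::comm_ring_1) mpoly \<Rightarrow> 'r::comm_ring_1" where
  "subst h \<phi> p = (\<Sum>m\<in>Poly_Mapping.keys p. h (Poly_Mapping.lookup p m) * subst_monom \<phi> m)"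

lemma subst_monom_add: "subst_monom \<phi> (m + n) = subst_monom \<phi> m * subst_monom \<phi> n"
proof -
  let ?U = "Poly_Mapping.keys m \<union> Poly_Mapping.keys n"
  have *: "subst_monom \<phi> l = (\<Prod>x\<in>?U. \<phi> x ^ Poly_Mapping.lookup l x)"
    if "Poly_Mapping.keys l \<subseteq> ?U" for l
    unfolding subst_monom_def using that by (intro prod.mono_neutral_left) (auto simp: in_keys_iff)
  show ?thesis
    by (simp add: * Poly_Mapping.keys_add lookup_add power_add prod.distrib)
qed

lemma (in unital_hom) subst_hom: "unital_hom (subst h \<phi>)"
proof -
  have add: "subst h \<phi> (p + q) = subst h \<phi> p + subst h \<phi> q" for p q
    unfolding subst_def
    by (intro setsum_keys_plus_distrib) (simp_all add: hom_zero hom_add distrib_right)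
  have zero: "subst h \<phi> 0 = 0"
    by (simp add: subst_def)
  have sum: "subst h \<phi> (\<Sum>i\<in>I. g i) = (\<Sum>i\<in>I. subst h \<phi> (g i))" for g and I :: "'i set"
    by (induction I rule: infinite_finite_induct) (simp_all add: zero add)
  have single: "subst h \<phi> (Poly_Mapping.single m c) = h c * subst_monom \<phi> m" for m c
    by (simp add: subst_def hom_zero)
  have "subst h \<phi> (p * q) = subst h \<phi> p * subst h \<phi> q" for p q
  proof -
    let ?a = "Poly_Mapping.lookup p" and ?b = "Poly_Mapping.lookup q"
    have "p * q = (\<Sum>m\<in>Poly_Mapping.keys p. \<Sum>n\<in>Poly_Mapping.keys q.
        Poly_Mapping.single (m + n) (?a m * ?b n))"
      unfolding mult_single [symmetric] sum_distrib_left [symmetric] sum_distrib_right [symmetric]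
      by (simp flip: poly_mapping_sum_single)
    then show ?thesis
      by (simp add: sum single hom_mult subst_monom_add)
         (simp add: subst_def sum_product ac_simps)
  qed
  moreover have "subst h \<phi> 1 = 1"
    using single [of 0 1] by (simp add: hom_one subst_monom_def)
  ultimately show ?thesis
    using add by unfold_locales
qed

lemma (in unital_hom) subst_const: "subst h \<phi> (const c) = h c"
  by (simp add: subst_def const_def hom_zero subst_monom_def)

lemma (in unital_hom) subst_mvar: "subst h \<phi> (mvar x) = \<phi> x"
  by (simp add: subst_def mvar_def hom_one subst_monom_def)

lemma unital_hom_id: "unital_hom (\<lambda>c. c)"
  and unital_hom_const: "unital_hom const"
  and unital_hom_pCons: "unital_hom (\<lambda>c. [:c:])"
  by unfold_locales (simp_all add: const_add const_mult)

lemma unital_hom_comp: "unital_hom g \<Longrightarrow> unital_hom h \<Longrightarrow> unital_hom (\<lambda>a. g (h a))"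
  by (simp add: unital_hom_def)

definition retract :: "'x set \<Rightarrow> ('x, 'k::comm_ring_1) mpoly \<Rightarrow> ('x, 'k) mpoly" where
  "retract X = subst const (\<lambda>x. if x \<in> X then mvar x else 0)"

lemma unital_hom_retract: "unital_hom (retract X)"
  unfolding retract_def by (rule unital_hom.subst_hom [OF unital_hom_const])

interpretation retract: unital_hom "retract X" for X
  by (rule unital_hom_retract)

lemma retract_const: "retract X (const c) = const c"
  by (simp add: retract_def unital_hom.subst_const [OF unital_hom_const])

lemma retract_mvar: "retract X (mvar x) = (if x \<in> X then mvar x else 0)"
  by (simp add: retract_def unital_hom.subst_mvar [OF unital_hom_const])

lemma in_polys_UNIV: "p \<in> polys UNIV"
  by (simp add: polys_iff)

lemma retract_in_polys [simp]: "retract X p \<in> polys X"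
  using in_polys_UNIV [of p]
  by (induction rule: polys_induct)
     (simp_all add: retract_const retract_mvar retract.hom_add retract.hom_mult)

lemma retract_id: "p \<in> polys X \<Longrightarrow> retract X p = p"
  by (induction rule: polys_induct)
     (simp_all add: retract_const retract_mvar retract.hom_add retract.hom_mult)

text \<open>
  The remainder under division by a variable is the specialisation of that variable to zero.
\<close>

lemma polys_insert_decompose:
  assumes "p \<in> polys (insert x X)" "x \<notin> X"
  obtains q where "q \<in> polys (insert x X)" "p = retract X p + mvar x * q"
proof -
  have "\<exists>q\<in>polys (insert x X). p = retract X p + mvar x * q"
    using assms(1)
  proof (induction rule: polys_induct)
    case (const c)
    show ?case by (intro bexI [of _ 0]) (simp_all add: retract_const)
  next
    case (mvar y)
    show ?case
      using mvar assms(2)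
      by (cases "y = x") (auto simp: retract_mvar intro: bexI [of _ 1] bexI [of _ 0])
  next
    case (add p q)
    then obtain p' q' where "p' \<in> polys (insert x X)" "q' \<in> polys (insert x X)"
      "p = retract X p + mvar x * p'" "q = retract X q + mvar x * q'"
      by blast
    then show ?case
      by (intro bexI [of _ "p' + q'"]) (simp_all add: retract.hom_add algebra_simps)
  next
    case (mult p q)
    then obtain p' q' where *: "p' \<in> polys (insert x X)" "q' \<in> polys (insert x X)"
      "p = retract X p + mvar x * p'" "q = retract X q + mvar x * q'"
      by blast
    have "retract X p \<in> polys (insert x X)"
      by (rule polys_mono [OF subset_insertI retract_in_polys])
    moreover have "p * q = retract X (p * q) + mvar x * (retract X p * q' + p' * q)"
      by (subst *(3), subst *(4), subst (3) *(4)) (simp add: retract.hom_mult algebra_simps)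
    ultimately show ?case
      using * mult by (intro bexI [of _ "retract X p * q' + p' * q"]) simp_all
  qed
  then show ?thesis using that by blast
qed

lemma mvar_mult_eq_0:
  assumes "mvar x * p = 0"
  shows "p = 0"
proof (rule poly_mapping_eqI)
  fix m
  have "Poly_Mapping.lookup (mvar x * p) (Poly_Mapping.single x 1 + m) = Poly_Mapping.lookup p m"
    by (simp add: lookup_mult mvar_def lookup_single when_mult)
  then show "Poly_Mapping.lookup p m = Poly_Mapping.lookup 0 m"
    using assms by simp
qed

section \<open>Degree and truncation\<close>

definition total_deg :: "('x \<Rightarrow>\<^sub>0 nat) \<Rightarrow> nat" where
  "total_deg m = (\<Sum>x\<in>Poly_Mapping.keys m. Poly_Mapping.lookup m x)"

lemma total_deg_add: "total_deg (m + n) = total_deg m + total_deg n"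
  unfolding total_deg_def by (intro setsum_keys_plus_distrib) simp_all

definition deg_ge :: "nat \<Rightarrow> ('x, 'k::comm_ring_1) mpoly set" where
  "deg_ge N = {p. \<forall>m\<in>Poly_Mapping.keys p. N \<le> total_deg m}"

definition deg_le :: "nat \<Rightarrow> ('x, 'k::comm_ring_1) mpoly set" where
  "deg_le N = {p. \<forall>m\<in>Poly_Mapping.keys p. total_deg m \<le> N}"

definition quadric :: "('x, 'k::comm_ring_1) mpoly \<Rightarrow> bool" where
  "quadric p \<longleftrightarrow> p \<in> deg_ge 2 \<inter> deg_le 2"

lemma deg_ge_zero [simp]: "0 \<in> deg_ge N" and deg_le_zero [simp]: "0 \<in> deg_le N"
  by (simp_all add: deg_ge_def deg_le_def)

lemma deg_ge_0 [simp]: "p \<in> deg_ge 0"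
  by (simp add: deg_ge_def)

lemma deg_ge_add [simp]: "p \<in> deg_ge N \<Longrightarrow> q \<in> deg_ge N \<Longrightarrow> p + q \<in> deg_ge N"
  using Poly_Mapping.keys_add [of p q] by (auto simp: deg_ge_def)

lemma deg_le_add [simp]: "p \<in> deg_le N \<Longrightarrow> q \<in> deg_le N \<Longrightarrow> p + q \<in> deg_le N"
  using Poly_Mapping.keys_add [of p q] by (auto simp: deg_le_def)

lemma deg_ge_sum [simp]: "(\<And>i. i \<in> I \<Longrightarrow> g i \<in> deg_ge N) \<Longrightarrow> (\<Sum>i\<in>I. g i) \<in> deg_ge N"
  by (induction I rule: infinite_finite_induct) simp_all

lemma deg_le_sum [simp]: "(\<And>i. i \<in> I \<Longrightarrow> g i \<in> deg_le N) \<Longrightarrow> (\<Sum>i\<in>I. g i) \<in> deg_le N"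
  by (induction I rule: infinite_finite_induct) simp_all

lemma deg_ge_mult: "p \<in> deg_ge M \<Longrightarrow> q \<in> deg_ge N \<Longrightarrow> p * q \<in> deg_ge (M + N)"
  unfolding deg_ge_def using keys_mult [of p q] by (fastforce simp: total_deg_add intro: add_mono)

lemma deg_le_mult: "p \<in> deg_le M \<Longrightarrow> q \<in> deg_le N \<Longrightarrow> p * q \<in> deg_le (M + N)"
  unfolding deg_le_def using keys_mult [of p q] by (fastforce simp: total_deg_add intro: add_mono)

lemma deg_ge_mult_right: "q \<in> deg_ge N \<Longrightarrow> p * q \<in> deg_ge N"
  using deg_ge_mult [of p 0 q N] by simp

lemma deg_ge_power: "p \<in> deg_ge 1 \<Longrightarrow> p ^ n \<in> deg_ge n"
  using deg_ge_mult [of p 1 "p ^ (n - 1)" "n - 1" for n]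
  by (induction n) (use deg_ge_mult [of p 1] in force)+

lemma mvar_deg_ge_1 [simp]: "mvar x \<in> deg_ge 1" and mvar_deg_le_1 [simp]: "mvar x \<in> deg_le 1"
  by (simp_all add: deg_ge_def deg_le_def mvar_def total_deg_def)

lemma deg_le_exists:
  assumes "finite I"
  shows "\<exists>D. \<forall>i\<in>I. c i \<in> deg_le D"
proof -
  let ?S = "\<Union>i\<in>I. total_deg ` Poly_Mapping.keys (c i)"
  have "finite ?S" using assms by simp
  then have "\<forall>i\<in>I. c i \<in> deg_le (Max ?S)"
    by (auto simp: deg_le_def intro!: Max_ge)
  then show ?thesis ..
qed

lemma deg_le_mono: "p \<in> deg_le M \<Longrightarrow> M \<le> N \<Longrightarrow> p \<in> deg_le N"
  by (auto simp: deg_le_def intro: order_trans)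

definition trunc :: "nat \<Rightarrow> ('x, 'k::comm_ring_1) mpoly \<Rightarrow> ('x, 'k) mpoly" where
  "trunc D = Poly_Mapping.mapp (\<lambda>m c. c when total_deg m \<le> D)"

lemma lookup_trunc:
  "Poly_Mapping.lookup (trunc D p) m = (Poly_Mapping.lookup p m when total_deg m \<le> D)"
  by (auto simp: trunc_def lookup_mapp when_def in_keys_iff)

lemma trunc_zero [simp]: "trunc D 0 = 0"
  and trunc_add: "trunc D (p + q) = trunc D p + trunc D q"
  and trunc_uminus: "trunc D (- p) = - trunc D p"
  by (rule poly_mapping_eqI; simp add: lookup_trunc lookup_add when_add_distrib when_uminus_distrib)+

lemma trunc_diff: "trunc D (p - q) = trunc D p - trunc D q"
  using trunc_add [of D p "- q"] by (simp add: trunc_uminus)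

lemma trunc_sum: "trunc D (\<Sum>i\<in>I. g i) = (\<Sum>i\<in>I. trunc D (g i))"
  by (induction I rule: infinite_finite_induct) (simp_all add: trunc_add)

lemma trunc_in_polys [simp]: "p \<in> polys X \<Longrightarrow> trunc D p \<in> polys X"
  by (simp add: polys_iff in_keys_iff lookup_trunc)

lemma trunc_id: "p \<in> deg_le D \<Longrightarrow> trunc D p = p"
  by (rule poly_mapping_eqI) (auto simp: lookup_trunc when_def deg_le_def in_keys_iff)

lemma trunc_eq_0: "p \<in> deg_ge (Suc D) \<Longrightarrow> trunc D p = 0"
  by (rule poly_mapping_eqI) (force simp: lookup_trunc when_def deg_ge_def in_keys_iff)

text \<open>
  Why truncation is compatible with ideals generated by quadrics: it acts on the coefficients of a
  combination of the generators.
\<close>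

lemma trunc_mult_quadric:
  assumes "quadric f"
  shows "trunc (D + 2) (p * f) = trunc D p * f"
proof -
  have "trunc D p \<in> deg_le D" "p - trunc D p \<in> deg_ge (Suc D)"
    by (auto simp: deg_le_def deg_ge_def in_keys_iff lookup_trunc lookup_minus when_def split: if_splits)
  then have "trunc D p * f \<in> deg_le (D + 2)" "(p - trunc D p) * f \<in> deg_ge (Suc (D + 2))"
    using assms deg_le_mult [of "trunc D p" D f 2] deg_ge_mult [of "p - trunc D p" "Suc D" f 2]
    by (auto simp: quadric_def)
  then have "trunc (D + 2) (trunc D p * f + (p - trunc D p) * f) = trunc D p * f"
    by (simp only: trunc_add trunc_id trunc_eq_0 add_0_right)
  then show ?thesis by (simp add: algebra_simps)
qed

section \<open>Ideals and syzygies of families of quadrics\<close>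

text \<open>
  Rings \<open>k[X]\<close> are handled as the subsets \<open>polys X\<close> of one type, and an ideal of \<open>k[X]\<close> is given by
  an indexed family of generators. The notions below refer to the subring, not to the whole type.
\<close>

definition gen_ideal :: "'x set \<Rightarrow> ('i \<Rightarrow> ('x, 'k::comm_ring_1) mpoly) \<Rightarrow> 'i set \<Rightarrow> ('x, 'k) mpoly set" where
  "gen_ideal X f I = {p. \<exists>c. (\<forall>i\<in>I. c i \<in> polys X) \<and> p = (\<Sum>i\<in>I. c i * f i)}"

definition nonzerodivisor_mod ::
    "'x set \<Rightarrow> ('x, 'k::comm_ring_1) mpoly \<Rightarrow> ('x, 'k) mpoly set \<Rightarrow> bool" where
  "nonzerodivisor_mod X x Q \<longleftrightarrow> (\<forall>a\<in>polys X. x * a \<in> Q \<longrightarrow> a \<in> Q)"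

definition prime_in :: "'x set \<Rightarrow> ('x, 'k::comm_ring_1) mpoly set \<Rightarrow> bool" where
  "prime_in X P \<longleftrightarrow> 1 \<notin> P \<and> (\<forall>a\<in>polys X. \<forall>b\<in>polys X. a * b \<in> P \<longrightarrow> a \<in> P \<or> b \<in> P)"

definition syzygy ::
    "'x set \<Rightarrow> ('i \<Rightarrow> ('x, 'k::comm_ring_1) mpoly) \<Rightarrow> 'i set \<Rightarrow> ('i \<Rightarrow> ('x, 'k) mpoly) \<Rightarrow> bool" where
  "syzygy X f I c \<longleftrightarrow> (\<forall>i\<in>I. c i \<in> polys X) \<and> (\<Sum>i\<in>I. c i * f i) = 0"

text \<open>
  The zero diagonal is a separate requirement for the sake of characteristic two.
\<close>

definition alternating :: "'x set \<Rightarrow> 'i set \<Rightarrow> ('i \<Rightarrow> 'i \<Rightarrow> ('x, 'k::comm_ring_1) mpoly) \<Rightarrow> bool" where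
  "alternating X I K \<longleftrightarrow>
     (\<forall>i\<in>I. \<forall>j\<in>I. K i j \<in> polys X \<and> K i j + K j i = 0) \<and> (\<forall>i\<in>I. K i i = 0)"

text \<open>
  These are the combinations of the trivial syzygies \<open>f\<^sub>j e\<^sub>i - f\<^sub>i e\<^sub>j\<close>, with coefficients collected in
  an alternating matrix.
\<close>

definition koszul ::
    "'x set \<Rightarrow> ('i \<Rightarrow> ('x, 'k::comm_ring_1) mpoly) \<Rightarrow> 'i set \<Rightarrow> ('i \<Rightarrow> ('x, 'k) mpoly) \<Rightarrow> bool" where
  "koszul X f I c \<longleftrightarrow> (\<exists>K. alternating X I K \<and> (\<forall>i\<in>I. c i = (\<Sum>j\<in>I. K i j * f j)))"

definition koszul_acyclic :: "'x set \<Rightarrow> ('i \<Rightarrow> ('x, 'k::comm_ring_1) mpoly) \<Rightarrow> 'i set \<Rightarrow> bool" where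
  "koszul_acyclic X f I \<longleftrightarrow> (\<forall>c. syzygy X f I c \<longrightarrow> koszul X f I c)"

lemma nonzerodivisor_modD: "nonzerodivisor_mod X x Q \<Longrightarrow> x * a \<in> Q \<Longrightarrow> a \<in> polys X \<Longrightarrow> a \<in> Q"
  by (simp add: nonzerodivisor_mod_def)

lemma gen_idealI: "(\<And>i. i \<in> I \<Longrightarrow> c i \<in> polys X) \<Longrightarrow> (\<Sum>i\<in>I. c i * f i) \<in> gen_ideal X f I"
  by (auto simp: gen_ideal_def)

lemma gen_idealE:
  assumes "p \<in> gen_ideal X f I"
  obtains c where "\<And>i. i \<in> I \<Longrightarrow> c i \<in> polys X" "p = (\<Sum>i\<in>I. c i * f i)"
  using assms by (auto simp: gen_ideal_def)

lemma gen_ideal_cong: "(\<And>i. i \<in> I \<Longrightarrow> f i = g i) \<Longrightarrow> gen_ideal X f I = gen_ideal X g I"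
  by (auto simp: gen_ideal_def)

lemma gen_ideal_zero [simp]: "0 \<in> gen_ideal X f I"
  using gen_idealI [of I "\<lambda>_. 0" X f] by simp

lemma gen_ideal_add [simp]:
  assumes "p \<in> gen_ideal X f I" "q \<in> gen_ideal X f I"
  shows "p + q \<in> gen_ideal X f I"
proof -
  obtain a b where "\<And>i. i \<in> I \<Longrightarrow> a i \<in> polys X" "p = (\<Sum>i\<in>I. a i * f i)"
    "\<And>i. i \<in> I \<Longrightarrow> b i \<in> polys X" "q = (\<Sum>i\<in>I. b i * f i)"
    using assms unfolding gen_ideal_def by blast
  moreover have "(\<Sum>i\<in>I. (a i + b i) * f i) \<in> gen_ideal X f I"
    by (rule gen_idealI) (simp add: calculation)
  ultimately show ?thesis
    by (simp add: distrib_right sum.distrib)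
qed

lemma gen_ideal_mult [simp]:
  assumes "a \<in> polys X" "p \<in> gen_ideal X f I"
  shows "a * p \<in> gen_ideal X f I"
proof -
  obtain c where "\<And>i. i \<in> I \<Longrightarrow> c i \<in> polys X" "p = (\<Sum>i\<in>I. c i * f i)"
    using assms(2) unfolding gen_ideal_def by blast
  moreover have "(\<Sum>i\<in>I. (a * c i) * f i) \<in> gen_ideal X f I"
    by (rule gen_idealI) (simp add: calculation assms(1))
  ultimately show ?thesis
    by (simp add: sum_distrib_left mult.assoc)
qed

lemma gen_ideal_mult_right [simp]: "a \<in> polys X \<Longrightarrow> p \<in> gen_ideal X f I \<Longrightarrow> p * a \<in> gen_ideal X f I"
  using gen_ideal_mult [of a X p f I] by (simp add: mult.commute)

lemma gen_ideal_uminus [simp]: "p \<in> gen_ideal X f I \<Longrightarrow> - p \<in> gen_ideal X f I"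
  using gen_ideal_mult [of "- 1" X p f I] by simp

lemma gen_ideal_diff [simp]: "p \<in> gen_ideal X f I \<Longrightarrow> q \<in> gen_ideal X f I \<Longrightarrow> p - q \<in> gen_ideal X f I"
  using gen_ideal_add [of p X f I "- q"] by simp

lemma gen_ideal_sum [simp]: "(\<And>j. j \<in> J \<Longrightarrow> p j \<in> gen_ideal X f I) \<Longrightarrow> (\<Sum>j\<in>J. p j) \<in> gen_ideal X f I"
  by (induction J rule: infinite_finite_induct) simp_all

lemma gen_ideal_base [simp]:
  assumes "finite I" "i \<in> I"
  shows "f i \<in> gen_ideal X f I"
proof -
  have "(\<Sum>j\<in>I. (if j = i then 1 else 0) * f j) = (\<Sum>j\<in>I. if j = i then f j else 0)"
    by (rule sum.cong) simp_all
  then show ?thesis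
    using assms gen_idealI [of I "\<lambda>j. if j = i then 1 else 0" X f] by simp
qed

lemma gen_ideal_in_polys: "(\<And>i. i \<in> I \<Longrightarrow> f i \<in> polys X) \<Longrightarrow> gen_ideal X f I \<subseteq> polys X"
  by (auto simp: gen_ideal_def)

lemma gen_ideal_subsetI:
  assumes "\<And>i. i \<in> I \<Longrightarrow> f i \<in> gen_ideal X g J"
  shows "gen_ideal X f I \<subseteq> gen_ideal X g J"
  using assms by (auto elim!: gen_idealE intro!: gen_ideal_sum)

lemma gen_ideal_mono: "finite J \<Longrightarrow> I \<subseteq> J \<Longrightarrow> gen_ideal X f I \<subseteq> gen_ideal X f J"
  by (rule gen_ideal_subsetI) auto

lemma gen_ideal_insert:
  fixes f :: "'i \<Rightarrow> ('x, 'k::comm_ring_1) mpoly"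
  assumes "finite I" "i \<notin> I"
  shows "gen_ideal X f (insert i I) = {q + f i * a | q a. q \<in> gen_ideal X f I \<and> a \<in> polys X}"
proof safe
  fix p assume "p \<in> gen_ideal X f (insert i I)"
  then obtain c where c: "\<And>j. j \<in> insert i I \<Longrightarrow> c j \<in> polys X" "p = (\<Sum>j\<in>insert i I. c j * f j)"
    unfolding gen_ideal_def by blast
  then have "p = (\<Sum>j\<in>I. c j * f j) + f i * c i"
    using assms by (simp add: algebra_simps)
  then show "\<exists>q a. p = q + f i * a \<and> q \<in> gen_ideal X f I \<and> a \<in> polys X"
    using c(1) by (intro exI [of _ "\<Sum>j\<in>I. c j * f j"] exI [of _ "c i"] conjI gen_idealI) auto
next
  fix q a :: "('x, 'k) mpoly" assume "q \<in> gen_ideal X f I" "a \<in> polys X"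
  then show "q + f i * a \<in> gen_ideal X f (insert i I)"
    using assms gen_ideal_mono [of "insert i I" I X f] by (intro gen_ideal_add gen_ideal_mult_right) auto
qed

lemma gen_ideal_quadrics_subset_deg_ge_2:
  assumes "\<And>i. i \<in> I \<Longrightarrow> quadric (f i)"
  shows "gen_ideal X f I \<subseteq> deg_ge 2"
proof
  fix p assume "p \<in> gen_ideal X f I"
  then obtain c where "p = (\<Sum>i\<in>I. c i * f i)" unfolding gen_ideal_def by blast
  then show "p \<in> deg_ge 2"
    using assms by (auto simp: quadric_def intro!: deg_ge_sum deg_ge_mult_right)
qed

text \<open>
  A polynomial that agrees with elements of the ideal up to terms of arbitrarily high degree lies in
  the ideal: truncate above its own degree, which replaces an approximating element by another element
  of the ideal.
\<close>

lemma gen_ideal_separated: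
  assumes I: "finite I" "\<And>i. i \<in> I \<Longrightarrow> quadric (f i)"
    and p: "\<And>N. \<exists>q\<in>gen_ideal X f I. p - q \<in> deg_ge N"
  shows "p \<in> gen_ideal X f I"
proof -
  obtain D where "p \<in> deg_le D"
    using deg_le_exists [of "{()}" "\<lambda>_. p"] by auto
  then have D: "p \<in> deg_le (D + 2)" by (rule deg_le_mono) simp
  obtain q where q: "q \<in> gen_ideal X f I" "p - q \<in> deg_ge (Suc (D + 2))"
    using p by blast
  obtain c where c: "\<And>i. i \<in> I \<Longrightarrow> c i \<in> polys X" "q = (\<Sum>i\<in>I. c i * f i)"
    using q(1) unfolding gen_ideal_def by blast
  have "p = trunc (D + 2) q"
    using trunc_id [OF D] trunc_eq_0 [OF q(2)] by (simp add: trunc_diff)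
  also have "\<dots> = (\<Sum>i\<in>I. trunc D (c i) * f i)"
    unfolding c(2) trunc_sum by (intro sum.cong refl trunc_mult_quadric I)
  finally show ?thesis
    using c(1) gen_idealI [of I "\<lambda>i. trunc D (c i)" X f] by simp
qed

lemma alternatingI:
  assumes "\<And>i j. i \<in> I \<Longrightarrow> j \<in> I \<Longrightarrow> K i j \<in> polys X"
    "\<And>i j. i \<in> I \<Longrightarrow> j \<in> I \<Longrightarrow> K i j + K j i = 0" "\<And>i. i \<in> I \<Longrightarrow> K i i = 0"
  shows "alternating X I K"
  using assms by (simp add: alternating_def)

lemma alternatingD:
  assumes "alternating X I K"
  shows "i \<in> I \<Longrightarrow> j \<in> I \<Longrightarrow> K i j \<in> polys X" "i \<in> I \<Longrightarrow> K i i = 0"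
    "i \<in> I \<Longrightarrow> j \<in> I \<Longrightarrow> K i j = - K j i"
  using assms by (simp_all add: alternating_def eq_neg_iff_add_eq_0)

lemma alternating_add:
  assumes "alternating X I K" "alternating X I L"
  shows "alternating X I (\<lambda>i j. K i j + L i j)"
proof (rule alternatingI)
  fix i j assume "i \<in> I" "j \<in> I"
  then have "(K i j + K j i) + (L i j + L j i) = 0"
    using assms by (simp add: alternating_def)
  then show "K i j + L i j + (K j i + L j i) = 0"
    by (simp add: algebra_simps)
qed (use assms in \<open>simp_all add: alternatingD(1,2)\<close>)

lemma alternating_scale:
  "a \<in> polys X \<Longrightarrow> alternating X I K \<Longrightarrow> alternating X I (\<lambda>i j. a * K i j)"
  by (auto simp: alternating_def simp flip: distrib_left)

lemma alternating_subset: "I \<subseteq> J \<Longrightarrow> alternating X J K \<Longrightarrow> alternating X I K"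
  by (auto simp: alternating_def)

lemma alternating_image:
  assumes "alternating X I K" "h 0 = 0" "\<And>p q. h (p + q) = h p + h q"
    "\<And>p. p \<in> polys X \<Longrightarrow> h p \<in> polys Y"
  shows "alternating Y I (\<lambda>i j. h (K i j))"
  using assms by (auto simp: alternating_def simp flip: assms(3))

text \<open>
  In characteristic two this double sum cannot be shown to vanish by comparing it with its negative,
  hence the induction.
\<close>

lemma alternating_sum_eq_0:
  assumes "finite I" "alternating X I K"
  shows "(\<Sum>i\<in>I. (\<Sum>j\<in>I. K i j * f j) * f i) = 0"
  using assms
proof (induction I)
  case (insert s I)
  have K: "K s s = 0" "\<And>i. i \<in> I \<Longrightarrow> K i s = - K s i"
      by (rule alternatingD(2) [OF insert.prems], simp) (rule alternatingD(3) [OF insert.prems], simp_all)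
  have "(\<Sum>i\<in>insert s I. (\<Sum>j\<in>insert s I. K i j * f j) * f i) =
      (\<Sum>j\<in>I. K s j * f j * f s) + ((\<Sum>i\<in>I. K i s * f s * f i) + (\<Sum>i\<in>I. (\<Sum>j\<in>I. K i j * f j) * f i))"
    using insert.hyps K(1) by (simp add: distrib_right sum.distrib sum_distrib_right)
  also have "(\<Sum>i\<in>I. K i s * f s * f i) = - (\<Sum>j\<in>I. K s j * f j * f s)"
    unfolding sum_negf [symmetric]
  proof (intro sum.cong refl)
    fix i assume "i \<in> I"
    from K(2) [OF this] show "K i s * f s * f i = - (K s i * f i * f s)"
      by (simp add: ac_simps)
  qed
  also have "(\<Sum>i\<in>I. (\<Sum>j\<in>I. K i j * f j) * f i) = 0"
    by (intro insert.IH alternating_subset [OF subset_insertI insert.prems])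
  finally show ?case by simp
qed simp

lemma syzygy_diff_alternating:
  assumes "finite I" "\<And>i. i \<in> I \<Longrightarrow> f i \<in> polys X" "syzygy X f I c" "alternating X I K"
  shows "syzygy X f I (\<lambda>i. c i - (\<Sum>j\<in>I. K i j * f j))"
  using assms alternating_sum_eq_0 [of I X K f]
  by (auto simp: syzygy_def left_diff_distrib sum_subtractf alternating_def intro!: polys_diff polys_sum polys_mult)

text \<open>
  Graded Nakayama for the syzygies modulo the Koszul ones: the remainder after sufficiently many
  corrections by Koszul syzygies has too high a degree to survive truncation. The predicate \<open>Z t\<close>
  describes the remainder after \<open>t\<close> corrections.
\<close>

lemma koszul_if_approximable:
  assumes I: "finite I" "\<And>i. i \<in> I \<Longrightarrow> quadric (f i)"
    and c: "Z 0 c"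
    and step: "\<And>t c. Z t c \<Longrightarrow> \<exists>K. alternating X I K \<and> Z (Suc t) (\<lambda>i. c i - (\<Sum>j\<in>I. K i j * f j))"
    and deg: "\<And>t c i. Z t c \<Longrightarrow> i \<in> I \<Longrightarrow> c i \<in> deg_ge t"
  shows "koszul X f I c"
proof -
  have approx: "\<exists>K. alternating X I K \<and> Z t (\<lambda>i. c i - (\<Sum>j\<in>I. K i j * f j))" for t
  proof (induction t)
    case 0
    show ?case using c by (intro exI [of _ "\<lambda>i j. 0"]) (simp add: alternating_def)
  next
    case (Suc t)
    then obtain K where K: "alternating X I K" "Z t (\<lambda>i. c i - (\<Sum>j\<in>I. K i j * f j))" by blast
    from step [OF K(2)] obtain L where L: "alternating X I L"
      "Z (Suc t) (\<lambda>i. c i - (\<Sum>j\<in>I. K i j * f j) - (\<Sum>j\<in>I. L i j * f j))" by blast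
    then show ?case
      using K(1) alternating_add [of X I K L]
      by (intro exI [of _ "\<lambda>i j. K i j + L i j"]) (simp add: distrib_right sum.distrib algebra_simps)
  qed
  obtain D where "\<forall>i\<in>I. c i \<in> deg_le D"
    using deg_le_exists [OF I(1)] by blast
  then have D: "c i \<in> deg_le (D + 2)" if "i \<in> I" for i
    using that deg_le_mono [of "c i" D "D + 2"] by simp
  obtain K where K: "alternating X I K"
    "Z (Suc (D + 2)) (\<lambda>i. c i - (\<Sum>j\<in>I. K i j * f j))"
    using approx by blast
  have "c i = (\<Sum>j\<in>I. trunc D (K i j) * f j)" if "i \<in> I" for i
  proof -
    have "c i = trunc (D + 2) (\<Sum>j\<in>I. K i j * f j)"
      using trunc_id [OF D [OF that]] trunc_eq_0 [OF deg [OF K(2) that]] by (simp add: trunc_diff)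
    also have "\<dots> = (\<Sum>j\<in>I. trunc D (K i j) * f j)"
      unfolding trunc_sum by (intro sum.cong refl trunc_mult_quadric I)
    finally show ?thesis .
  qed
  moreover have "alternating X I (\<lambda>i j. trunc D (K i j))"
    using K(1) by (rule alternating_image) (simp_all add: trunc_add)
  ultimately show ?thesis
    unfolding koszul_def by blast
qed

section \<open>Koszul acyclicity and regular sequences\<close>

lemma koszul_acyclicD:
  "koszul_acyclic X f I \<Longrightarrow> syzygy X f I c \<Longrightarrow>
    \<exists>K. alternating X I K \<and> (\<forall>i\<in>I. c i = (\<Sum>j\<in>I. K i j * f j))"
  by (simp add: koszul_acyclic_def koszul_def)

text \<open>
  If \<open>f\<^sub>s\<close> is a nonzerodivisor modulo the other generators, then the coefficient of \<open>f\<^sub>s\<close> in a syzygy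
  lies in the ideal of the others; subtracting a Koszul syzygy makes it vanish.
\<close>

lemma koszul_acyclic_insert:
  assumes "finite I" "s \<notin> I" and f: "\<And>i. i \<in> insert s I \<Longrightarrow> f i \<in> polys X"
    and I: "koszul_acyclic X f I" and s: "nonzerodivisor_mod X (f s) (gen_ideal X f I)"
  shows "koszul_acyclic X f (insert s I)"
  unfolding koszul_acyclic_def
proof (intro allI impI)
  fix c assume c: "syzygy X f (insert s I) c"
  then have cX: "\<And>i. i \<in> insert s I \<Longrightarrow> c i \<in> polys X"
    and eq: "c s * f s + (\<Sum>i\<in>I. c i * f i) = 0"
    using assms(1,2) by (auto simp: syzygy_def)
  have "f s * c s = - (\<Sum>i\<in>I. c i * f i)"
    using eq by (simp only: mult.commute [of "f s" "c s"] add_eq_0_iff2)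
  moreover have "(\<Sum>i\<in>I. c i * f i) \<in> gen_ideal X f I"
    by (rule gen_idealI) (use cX in simp)
  ultimately have "f s * c s \<in> gen_ideal X f I"
    by simp
  then have "c s \<in> gen_ideal X f I"
    by (rule nonzerodivisor_modD [OF s]) (simp add: cX)
  then obtain k where k: "\<And>i. i \<in> I \<Longrightarrow> k i \<in> polys X" "c s = (\<Sum>i\<in>I. k i * f i)"
    unfolding gen_ideal_def by blast
  have "(\<Sum>i\<in>I. (c i + k i * f s) * f i) = (\<Sum>i\<in>I. c i * f i) + (\<Sum>i\<in>I. k i * f i) * f s"
    unfolding distrib_right sum.distrib sum_distrib_right by (simp add: mult.assoc mult.commute [of "f s"])
  also have "\<dots> = 0"
    using eq by (simp only: k(2) add.commute)
  finally have "syzygy X f I (\<lambda>i. c i + k i * f s)"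
    using cX k(1) f by (simp add: syzygy_def)
  then obtain K where K: "alternating X I K" "\<And>i. i \<in> I \<Longrightarrow> c i + k i * f s = (\<Sum>j\<in>I. K i j * f j)"
    using koszul_acyclicD [OF I] by blast
  define L where "L i j = (if i = s then if j = s then 0 else k j else if j = s then - k i else K i j)" for i j
  have "alternating X (insert s I) L"
    using K(1) k(1) assms(2) by (auto simp: alternating_def L_def)
  moreover have "c i = (\<Sum>j\<in>insert s I. L i j * f j)" if "i \<in> insert s I" for i
  proof (cases "i = s")
    case True
    then have "(\<Sum>j\<in>I. L i j * f j) = (\<Sum>j\<in>I. k j * f j)"
      using assms(2) by (intro sum.cong) (auto simp: L_def)
    with True show ?thesis using assms(1,2) k(2) by (simp add: L_def)
  next
    case False
    then have "(\<Sum>j\<in>I. L i j * f j) = (\<Sum>j\<in>I. K i j * f j)"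
      using assms(2) by (intro sum.cong) (auto simp: L_def)
    then have "(\<Sum>j\<in>insert s I. L i j * f j) = - k i * f s + (\<Sum>j\<in>I. K i j * f j)"
      using assms(1,2) False by (simp add: L_def)
    also have "\<dots> = c i"
      using that False K(2) [of i, symmetric] by simp
    finally show ?thesis by simp
  qed
  ultimately show "koszul X f (insert s I) c"
    unfolding koszul_def by blast
qed

text \<open>
  If \<open>f\<^sub>s a\<close> is in the ideal, then \<open>a\<close> is the coefficient at \<open>s\<close> of a syzygy. This syzygy is
  Koszul, and row \<open>s\<close> of an alternating matrix has no diagonal entry.
\<close>

lemma koszul_acyclic_nonzerodivisor:
  assumes "finite I" "s \<notin> I" and ac: "koszul_acyclic X f (insert s I)"
  shows "nonzerodivisor_mod X (f s) (gen_ideal X f I)"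
  unfolding nonzerodivisor_mod_def
proof (intro ballI impI)
  fix a assume a: "a \<in> polys X" "f s * a \<in> gen_ideal X f I"
  then obtain k where k: "\<And>i. i \<in> I \<Longrightarrow> k i \<in> polys X" "f s * a = (\<Sum>i\<in>I. k i * f i)"
    unfolding gen_ideal_def by blast
  define c where "c i = (if i = s then a else - k i)" for i
  have "(\<Sum>i\<in>I. c i * f i) = (\<Sum>i\<in>I. - (k i * f i))"
    using assms(2) by (intro sum.cong) (auto simp: c_def)
  then have "syzygy X f (insert s I) c"
    using a(1) k assms(1,2) by (auto simp: syzygy_def c_def sum_negf mult.commute [of a])
  then obtain K where K: "alternating X (insert s I) K" "c s = (\<Sum>j\<in>insert s I. K s j * f j)"
    using koszul_acyclicD [OF ac] by blast
  then have "a = (\<Sum>j\<in>I. K s j * f j)"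
    using assms(1,2) by (simp add: c_def alternating_def)
  then show "a \<in> gen_ideal X f I"
    using K(1) gen_idealI [of I "K s" X f] by (auto simp: alternating_def)
qed

lemma quadric_deg_ge_1: "quadric f \<Longrightarrow> f \<in> deg_ge 1"
  by (auto simp: quadric_def deg_ge_def)

text \<open>
  Extend a syzygy \<open>c\<close> of the smaller family by zero and write it as \<open>K f\<close> with \<open>K\<close> alternating. Then
  \<open>c\<close> differs from a Koszul syzygy of the smaller family by \<open>f\<^sub>s\<close> times the column \<open>s\<close> of \<open>K\<close>, and that column
  is again a syzygy of the smaller family because \<open>c\<^sub>s = 0\<close>. Iterating gives remainders divisible by
  high powers of \<open>f\<^sub>s\<close>.
\<close>

lemma koszul_acyclic_remove:
  assumes fin: "finite I" "s \<notin> I"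
    and f: "\<And>i. i \<in> insert s I \<Longrightarrow> f i \<in> polys X" "\<And>i. i \<in> insert s I \<Longrightarrow> quadric (f i)"
    and ac: "koszul_acyclic X f (insert s I)"
  shows "koszul_acyclic X f I"
  unfolding koszul_acyclic_def
proof (intro allI impI)
  fix c assume "syzygy X f I c"
  define Z where "Z t c \<longleftrightarrow> (\<exists>b. syzygy X f I b \<and> (\<forall>i\<in>I. c i = f s ^ t * b i))" for t c
  show "koszul X f I c"
  proof (rule koszul_if_approximable [where Z = Z])
    show "Z 0 c"
      unfolding Z_def using \<open>syzygy X f I c\<close> by (intro exI [of _ c]) simp
  next
    fix t c assume "Z t c"
    then obtain b where b: "syzygy X f I b" "\<And>i. i \<in> I \<Longrightarrow> c i = f s ^ t * b i"
      unfolding Z_def by blast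
    define b' where "b' i = (if i = s then 0 else b i)" for i
    have "(\<Sum>i\<in>I. b' i * f i) = (\<Sum>i\<in>I. b i * f i)"
      using fin(2) by (intro sum.cong) (auto simp: b'_def)
    then have "syzygy X f (insert s I) b'"
      using b(1) fin by (auto simp: syzygy_def b'_def)
    then obtain K where K: "alternating X (insert s I) K"
      "\<And>i. i \<in> insert s I \<Longrightarrow> b' i = (\<Sum>j\<in>insert s I. K i j * f j)"
      using koszul_acyclicD [OF ac] by blast
    have Ks: "K s s = 0" "\<And>i. i \<in> I \<Longrightarrow> K i s = - K s i"
      by (rule alternatingD(2) [OF K(1)], simp) (rule alternatingD(3) [OF K(1)], simp_all)
    have "(\<Sum>j\<in>I. K s j * f j) = 0"
      using K(2) [of s] fin Ks(1) by (simp add: b'_def)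
    moreover have "(\<Sum>i\<in>I. K i s * f i) = (\<Sum>i\<in>I. - (K s i * f i))"
      by (intro sum.cong refl) (subst Ks(2), simp_all)
    ultimately have syz: "syzygy X f I (\<lambda>i. K i s)"
      unfolding syzygy_def using alternatingD(1) [OF K(1)] by (simp only: sum_negf) simp
    have beq: "b i = K i s * f s + (\<Sum>j\<in>I. K i j * f j)" if "i \<in> I" for i
    proof -
      have "i \<noteq> s" using that fin(2) by blast
      then show ?thesis using that K(2) [of i] fin by (simp add: b'_def)
    qed
    have "c i - (\<Sum>j\<in>I. (f s ^ t * K i j) * f j) = f s ^ Suc t * K i s" if "i \<in> I" for i
    proof -
      have "(\<Sum>j\<in>I. (f s ^ t * K i j) * f j) = f s ^ t * (\<Sum>j\<in>I. K i j * f j)"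
        by (simp only: sum_distrib_left mult.assoc)
      then show ?thesis
        unfolding b(2) [OF that] beq [OF that] by (simp only:) (simp add: distrib_left)
    qed
    moreover have "alternating X I (\<lambda>i j. f s ^ t * K i j)"
      by (rule alternating_scale [OF _ alternating_subset [OF subset_insertI K(1)]]) (simp add: f(1))
    ultimately show "\<exists>K. alternating X I K \<and> Z (Suc t) (\<lambda>i. c i - (\<Sum>j\<in>I. K i j * f j))"
      using syz unfolding Z_def
      by (intro exI [of _ "\<lambda>i j. f s ^ t * K i j"] exI [of _ "\<lambda>i. K i s"] conjI) auto
  next
    fix t c i assume "Z t c" "i \<in> I"
    then obtain b where "c i = f s ^ t * b i" unfolding Z_def by blast
    moreover have "f s ^ t \<in> deg_ge t"
      using f(2) by (intro deg_ge_power quadric_deg_ge_1) auto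
    ultimately show "c i \<in> deg_ge t"
      using deg_ge_mult_right [of "f s ^ t" t "b i"] by (simp add: mult.commute)
  qed (use fin f in auto)
qed

lemma koszul_acyclic_subset:
  assumes "finite J" "I \<subseteq> J"
    and f: "\<And>i. i \<in> J \<Longrightarrow> f i \<in> polys X" "\<And>i. i \<in> J \<Longrightarrow> quadric (f i)"
    and "koszul_acyclic X f J"
  shows "koszul_acyclic X f I"
proof -
  have "koszul_acyclic X f I" if "finite D" "D \<inter> I = {}" "I \<union> D \<subseteq> J" "koszul_acyclic X f (I \<union> D)" for D
    using that
  proof (induction D)
    case (insert s D)
    then show ?case
      using assms finite_subset [of "I \<union> D" J]
      by (intro insert.IH koszul_acyclic_remove [of "I \<union> D" s f X]) auto
  qed simp
  from this [of "J - I"] show ?thesis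
    using assms by (simp add: Un_absorb1 Int_commute)
qed

lemma koszul_acyclic_empty: "koszul_acyclic X f {}"
  by (simp add: koszul_acyclic_def koszul_def alternating_def)

text \<open>
  Let \<open>f = A r\<close> and \<open>r = B f\<close>. For a syzygy \<open>c\<close> of \<open>f\<close>, the row vector \<open>c A\<close> is a syzygy of \<open>r\<close>, hence
  Koszul, and therefore \<open>c A B\<close> is a Koszul syzygy of \<open>f\<close>. The remainder is \<open>c N\<close> with \<open>N = 1 - A B\<close>. The rows
  of \<open>N\<close> are syzygies of \<open>f\<close>, so by minimality they have no constant terms, and \<open>c N\<close> vanishes to higher
  order than \<open>c\<close>.
\<close>

lemma koszul_acyclic_change_generators:
  assumes fin: "finite I" "finite J"
    and f: "\<And>i. i \<in> I \<Longrightarrow> f i \<in> polys X" "\<And>i. i \<in> I \<Longrightarrow> quadric (f i)"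
    and r: "koszul_acyclic X r J"
    and fr: "\<And>i. i \<in> I \<Longrightarrow> f i \<in> gen_ideal X r J" and rf: "\<And>j. j \<in> J \<Longrightarrow> r j \<in> gen_ideal X f I"
    and minimal: "\<And>c i. syzygy X f I c \<Longrightarrow> i \<in> I \<Longrightarrow> c i \<in> deg_ge 1"
  shows "koszul_acyclic X f I"
  unfolding koszul_acyclic_def
proof (intro allI impI)
  fix c assume c0: "syzygy X f I c"
  obtain A where A: "\<And>i j. i \<in> I \<Longrightarrow> j \<in> J \<Longrightarrow> A i j \<in> polys X" "\<And>i. i \<in> I \<Longrightarrow> f i = (\<Sum>j\<in>J. A i j * r j)"
    using fr unfolding gen_ideal_def by simp metis
  obtain B where B: "\<And>i j. j \<in> J \<Longrightarrow> i \<in> I \<Longrightarrow> B j i \<in> polys X" "\<And>j. j \<in> J \<Longrightarrow> r j = (\<Sum>i\<in>I. B j i * f i)"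
    using rf unfolding gen_ideal_def by simp metis
  define N where "N i l = (if i = l then 1 else 0) - (\<Sum>j\<in>J. A i j * B j l)" for i l
  have N_X: "N i l \<in> polys X" if "i \<in> I" "l \<in> I" for i l
    using that A(1) B(1) by (auto simp: N_def intro!: polys_diff polys_sum)
  have N_syz: "syzygy X f I (N i)" if "i \<in> I" for i
  proof -
    have "(\<Sum>l\<in>I. (\<Sum>j\<in>J. A i j * B j l) * f l) = (\<Sum>j\<in>J. A i j * (\<Sum>l\<in>I. B j l * f l))"
      unfolding sum_distrib_left sum_distrib_right by (subst sum.swap) (simp add: mult.assoc)
    also have "\<dots> = f i"
      unfolding A(2) [OF that] by (intro sum.cong refl) (simp flip: B(2))
    finally have "(\<Sum>l\<in>I. (\<Sum>j\<in>J. A i j * B j l) * f l) = f i" .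
    moreover have "(\<Sum>l\<in>I. (if i = l then 1 else 0) * f l) = (\<Sum>l\<in>I. if i = l then f l else 0)"
      by (rule sum.cong) auto
    ultimately show ?thesis
      using that fin N_X by (simp add: syzygy_def) (simp add: N_def left_diff_distrib sum_subtractf)
  qed
  define Z where "Z t c \<longleftrightarrow> syzygy X f I c \<and> (\<forall>i\<in>I. c i \<in> deg_ge t)" for t c
  show "koszul X f I c"
  proof (rule koszul_if_approximable [where Z = Z])
    show "Z 0 c" using c0 by (simp add: Z_def)
  next
    fix t c assume Z: "Z t c"
    then have c: "\<And>i. i \<in> I \<Longrightarrow> c i \<in> polys X" "(\<Sum>i\<in>I. c i * f i) = 0"
      by (auto simp: Z_def syzygy_def)
    have "(\<Sum>j\<in>J. (\<Sum>i\<in>I. c i * A i j) * r j) = (\<Sum>i\<in>I. c i * f i)"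
      unfolding sum_distrib_right
      by (subst sum.swap) (simp add: A(2) sum_distrib_left mult.assoc cong: sum.cong)
    then have "syzygy X r J (\<lambda>j. \<Sum>i\<in>I. c i * A i j)"
      using c A(1) by (auto simp: syzygy_def intro!: polys_sum)
    then obtain K where K: "alternating X J K"
      "\<And>j. j \<in> J \<Longrightarrow> (\<Sum>i\<in>I. c i * A i j) = (\<Sum>m\<in>J. K j m * r m)"
      using koszul_acyclicD [OF r] by blast
    define L where "L l i = (\<Sum>j\<in>J. \<Sum>m\<in>J. B j l * (K j m * B m i))" for l i
    have L: "alternating X I L"
    proof (rule alternatingI)
      fix l i assume li: "l \<in> I" "i \<in> I"
      show "L l i \<in> polys X"
        using li B(1) K(1) by (auto simp: L_def alternating_def intro!: polys_sum polys_mult)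
      have "L l i = (\<Sum>m\<in>J. \<Sum>j\<in>J. B j l * (K j m * B m i))"
        unfolding L_def by (rule sum.swap)
      also have "\<dots> = (\<Sum>m\<in>J. \<Sum>j\<in>J. - (B m i * (K m j * B j l)))"
      proof (intro sum.cong refl)
        fix m j assume "m \<in> J" "j \<in> J"
        then have "K j m = - K m j" by (intro alternatingD(3) [OF K(1)])
        then show "B j l * (K j m * B m i) = - (B m i * (K m j * B j l))" by simp
      qed
      also have "\<dots> = - L i l"
        by (simp add: L_def sum_negf)
      finally show "L l i + L i l = 0" by simp
    next
      fix l assume "l \<in> I"
      show "L l l = 0"
        using alternating_sum_eq_0 [OF fin(2) K(1), of "\<lambda>j. B j l"]
        by (simp add: L_def sum_distrib_left sum_distrib_right ac_simps)
    qed
    have cAB: "(\<Sum>i\<in>I. c i * (\<Sum>j\<in>J. A i j * B j l)) = (\<Sum>i\<in>I. L l i * f i)" if "l \<in> I" for l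
    proof -
      have "(\<Sum>i\<in>I. c i * (\<Sum>j\<in>J. A i j * B j l)) = (\<Sum>j\<in>J. B j l * (\<Sum>i\<in>I. c i * A i j))"
        unfolding sum_distrib_left by (subst sum.swap) (simp add: ac_simps)
      also have "\<dots> = (\<Sum>j\<in>J. B j l * (\<Sum>m\<in>J. K j m * (\<Sum>i\<in>I. B m i * f i)))"
        by (simp add: K(2) B(2) [symmetric])
      also have "\<dots> = (\<Sum>j\<in>J. \<Sum>m\<in>J. \<Sum>i\<in>I. B j l * (K j m * B m i) * f i)"
        by (simp add: sum_distrib_left mult.assoc)
      also have "\<dots> = (\<Sum>j\<in>J. \<Sum>i\<in>I. \<Sum>m\<in>J. B j l * (K j m * B m i) * f i)"
        by (intro sum.cong refl sum.swap)
      also have "\<dots> = (\<Sum>i\<in>I. \<Sum>j\<in>J. \<Sum>m\<in>J. B j l * (K j m * B m i) * f i)"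
        by (rule sum.swap)
      finally show ?thesis
        by (simp add: L_def sum_distrib_right)
    qed
    have rest: "c l - (\<Sum>i\<in>I. L l i * f i) = (\<Sum>i\<in>I. c i * N i l)" if "l \<in> I" for l
    proof -
      have "(\<Sum>i\<in>I. c i * (if i = l then 1 else 0)) = (\<Sum>i\<in>I. if i = l then c i else 0)"
        by (rule sum.cong) auto
      then have "(\<Sum>i\<in>I. c i * N i l) = c l - (\<Sum>i\<in>I. c i * (\<Sum>j\<in>J. A i j * B j l))"
        using that fin by (simp add: N_def right_diff_distrib sum_subtractf)
      then show ?thesis using cAB [OF that] by simp
    qed
    have "c l - (\<Sum>i\<in>I. L l i * f i) \<in> deg_ge (Suc t)" if "l \<in> I" for l
      unfolding rest [OF that]
    proof (rule deg_ge_sum)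
      fix i assume "i \<in> I"
      then have "c i \<in> deg_ge t" "N i l \<in> deg_ge 1"
        using Z that minimal [OF N_syz] by (auto simp: Z_def)
      then show "c i * N i l \<in> deg_ge (Suc t)"
        using deg_ge_mult by fastforce
    qed
    then show "\<exists>K. alternating X I K \<and> Z (Suc t) (\<lambda>i. c i - (\<Sum>j\<in>I. K i j * f j))"
      using L Z fin f syzygy_diff_alternating [of I f X c L] by (auto simp: Z_def)
  qed (use fin f in \<open>auto simp: Z_def\<close>)
qed

section \<open>Primality and specialisation\<close>

definition adjoin ::
    "'x set \<Rightarrow> ('x, 'k::comm_ring_1) mpoly set \<Rightarrow> ('x, 'k) mpoly \<Rightarrow> ('x, 'k) mpoly set" where
  "adjoin X Q x = {q + x * a | q a. q \<in> Q \<and> a \<in> polys X}"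

lemma prime_inD:
  "prime_in X P \<Longrightarrow> a * b \<in> P \<Longrightarrow> a \<in> polys X \<Longrightarrow> b \<in> polys X \<Longrightarrow> a \<in> P \<or> b \<in> P"
  by (auto simp: prime_in_def)

lemma prime_in_power:
  assumes "prime_in X P" "a ^ n * b \<in> P" "a \<notin> P" "a \<in> polys X" "b \<in> polys X"
  shows "b \<in> P"
  using assms(2)
proof (induction n)
  case (Suc n)
  then have "a * (a ^ n * b) \<in> P" by (simp add: mult.assoc)
  from prime_inD [OF assms(1) this] have "a ^ n * b \<in> P"
    using assms(3-5) by simp
  then show ?case by (rule Suc.IH)
qed simp

lemma subset_adjoin: "Q \<subseteq> adjoin X Q x"
proof
  fix q assume "q \<in> Q"
  then show "q \<in> adjoin X Q x"
    unfolding adjoin_def by (intro CollectI exI [of _ q] exI [of _ 0]) simp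
qed

lemma nonzerodivisor_mod_power:
  assumes "nonzerodivisor_mod X x Q" "x \<in> polys X" "x ^ n * a \<in> Q" "a \<in> polys X"
  shows "a \<in> Q"
  using assms(3)
proof (induction n)
  case (Suc n)
  then have "x * (x ^ n * a) \<in> Q" by (simp add: mult.assoc)
  from nonzerodivisor_modD [OF assms(1) this] have "x ^ n * a \<in> Q"
    using assms(2,4) by simp
  then show ?case by (rule Suc.IH)
qed simp

text \<open>
  Krull intersection for one element: iterating, \<open>z\<close> is congruent to a multiple of \<open>x\<^sup>N\<close> for every
  \<open>N\<close>, and \<open>x\<^sup>N\<close> has no terms of degree below \<open>N\<close>.
\<close>

lemma gen_ideal_divisible_forever:
  assumes I: "finite I" "\<And>i. i \<in> I \<Longrightarrow> quadric (f i)"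
    and x: "x \<in> polys X" "x \<in> deg_ge 1"
    and step: "\<And>z. z \<in> R \<Longrightarrow> \<exists>z'\<in>R. z - x * z' \<in> gen_ideal X f I"
    and z: "z \<in> R"
  shows "z \<in> gen_ideal X f I"
proof (rule gen_ideal_separated [OF I])
  fix N
  have "\<exists>z'\<in>R. z - x ^ N * z' \<in> gen_ideal X f I"
  proof (induction N)
    case 0
    show ?case using z by (intro bexI [of _ z]) simp_all
  next
    case (Suc N)
    then obtain z' where z': "z' \<in> R" "z - x ^ N * z' \<in> gen_ideal X f I" by blast
    from step [OF z'(1)] obtain z'' where z'': "z'' \<in> R" "z' - x * z'' \<in> gen_ideal X f I" by blast
    have "x ^ N * (z' - x * z'') \<in> gen_ideal X f I"
      using x(1) z''(2) by (intro gen_ideal_mult polys_power)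
    then have "(z - x ^ N * z') + x ^ N * (z' - x * z'') \<in> gen_ideal X f I"
      by (rule gen_ideal_add [OF z'(2)])
    then have "z - x ^ Suc N * z'' \<in> gen_ideal X f I"
      by (simp add: algebra_simps)
    with z''(1) show ?case by blast
  qed
  then obtain z' where "z - x ^ N * z' \<in> gen_ideal X f I" by blast
  moreover have "x ^ N * z' \<in> deg_ge N"
    using deg_ge_mult_right [OF deg_ge_power [OF x(2)], of z' N] by (simp only: mult.commute)
  ultimately show "\<exists>q\<in>gen_ideal X f I. z - q \<in> deg_ge N"
    by (intro bexI [of _ "z - x ^ N * z'"]) simp_all
qed simp

text \<open>
  It suffices to know that \<open>x\<close> is a nonzerodivisor after inverting an element \<open>s\<close> outside the prime
  ideal \<open>Q + (x)\<close>. If a power of \<open>s\<close> multiplies \<open>z\<close> into \<open>Q\<close>, then \<open>z \<in> Q + (x)\<close>, so modulo \<open>Q\<close> it is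
  a multiple \<open>x w\<close>, and a power of \<open>s\<close> multiplies \<open>w\<close> into \<open>Q\<close> as well.
\<close>

lemma nonzerodivisor_if_saturated:
  assumes I: "finite I" "\<And>i. i \<in> I \<Longrightarrow> quadric (f i)"
    and x: "x \<in> polys X" "x \<in> deg_ge 1"
    and P: "prime_in X (adjoin X (gen_ideal X f I) x)"
    and s: "s \<in> polys X" "s \<notin> adjoin X (gen_ideal X f I) x"
    and sat: "\<And>z. z \<in> polys X \<Longrightarrow> x * z \<in> gen_ideal X f I \<Longrightarrow> \<exists>N. s ^ N * z \<in> gen_ideal X f I"
  shows "nonzerodivisor_mod X x (gen_ideal X f I)"
  unfolding nonzerodivisor_mod_def
proof (intro ballI impI)
  let ?Q = "gen_ideal X f I"
  let ?R = "{z \<in> polys X. \<exists>N. s ^ N * z \<in> ?Q}"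
  fix z assume z: "z \<in> polys X" "x * z \<in> ?Q"
  show "z \<in> ?Q"
  proof (rule gen_ideal_divisible_forever [where R = ?R, OF I x])
    show "z \<in> ?R" using z sat by simp
  next
    fix z assume "z \<in> ?R"
    then obtain N where N: "z \<in> polys X" "s ^ N * z \<in> ?Q" by blast
    have "z \<in> adjoin X ?Q x"
      using prime_in_power [OF P _ s(2,1) N(1)] N(2) subset_adjoin by blast
    then obtain q w where w: "q \<in> ?Q" "w \<in> polys X" "z = q + x * w"
      unfolding adjoin_def by blast
    have "s ^ N * z - s ^ N * q \<in> ?Q"
      by (intro gen_ideal_diff N(2) gen_ideal_mult [OF polys_power [OF s(1)] w(1)])
    also have "s ^ N * z - s ^ N * q = x * (s ^ N * w)"
      unfolding w(3) by (simp add: algebra_simps)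
    finally obtain M where "s ^ M * (s ^ N * w) \<in> ?Q"
      using sat [of "s ^ N * w"] s(1) w(2) by auto
    then have "s ^ (M + N) * w \<in> ?Q"
      by (simp only: power_add mult.assoc)
    moreover have "z - x * w \<in> ?Q"
      unfolding w(3) using w(1) by simp
    ultimately show "\<exists>z'\<in>?R. z - x * z' \<in> ?Q"
      using w(2) by blast
  qed
qed

text \<open>
  Modulo \<open>Q\<close>, each element outside \<open>Q\<close> is a power of \<open>x\<close> times an element outside \<open>Q + (x)\<close>. A
  product of two such elements is a power of \<open>x\<close> times an element outside \<open>Q + (x)\<close>, and powers of \<open>x\<close>
  can be cancelled.
\<close>

lemma prime_in_if_prime_adjoin:
  assumes I: "finite I" "\<And>i. i \<in> I \<Longrightarrow> quadric (f i)"
    and x: "x \<in> polys X" "x \<in> deg_ge 1"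
    and P: "prime_in X (adjoin X (gen_ideal X f I) x)"
    and nzd: "nonzerodivisor_mod X x (gen_ideal X f I)"
  shows "prime_in X (gen_ideal X f I)"
proof -
  let ?Q = "gen_ideal X f I"
  let ?P = "adjoin X ?Q x"
  have factor: "\<exists>N. \<exists>a'\<in>polys X - ?P. a - x ^ N * a' \<in> ?Q" if "a \<in> polys X" "a \<notin> ?Q" for a
  proof (rule ccontr)
    let ?R = "{z \<in> polys X. \<not> (\<exists>N. \<exists>a'\<in>polys X - ?P. z - x ^ N * a' \<in> ?Q)}"
    assume contra: "\<not> ?thesis"
    have "a \<in> ?Q"
    proof (rule gen_ideal_divisible_forever [where R = ?R, OF I x])
      show "a \<in> ?R" using contra that(1) by blast
    next
      fix z assume z: "z \<in> ?R"
      have "z - x ^ 0 * z \<in> ?Q" by simp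
      with z have "z \<in> ?P" by blast
      then obtain q w where w: "q \<in> ?Q" "w \<in> polys X" "z = q + x * w"
        unfolding adjoin_def by blast
      have "z - x ^ Suc N * a' \<in> ?Q" if "w - x ^ N * a' \<in> ?Q" for N a'
      proof -
        have "q + x * (w - x ^ N * a') \<in> ?Q"
          using that w(1) x(1) by (intro gen_ideal_add gen_ideal_mult)
        then show ?thesis unfolding w(3) by (simp add: algebra_simps)
      qed
      then have "w \<in> ?R" using z w(2) by blast
      moreover have "z - x * w \<in> ?Q"
        unfolding w(3) using w(1) by simp
      ultimately show "\<exists>z'\<in>?R. z - x * z' \<in> ?Q" by blast
    qed
    with that(2) show False by blast
  qed
  show ?thesis
    unfolding prime_in_def
  proof (intro conjI ballI impI)
    show "1 \<notin> ?Q"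
      using P subset_adjoin [of ?Q X x] by (auto simp: prime_in_def)
  next
    fix a b assume ab: "a \<in> polys X" "b \<in> polys X" "a * b \<in> ?Q"
    show "a \<in> ?Q \<or> b \<in> ?Q"
    proof (rule ccontr)
      assume "\<not> (a \<in> ?Q \<or> b \<in> ?Q)"
      then obtain M N a' b' where
        a': "a' \<in> polys X" "a' \<notin> ?P" "a - x ^ M * a' \<in> ?Q" and
        b': "b' \<in> polys X" "b' \<notin> ?P" "b - x ^ N * b' \<in> ?Q"
        using factor [OF ab(1)] factor [OF ab(2)] by auto
      have "a * b - (a - x ^ M * a') * b - x ^ M * a' * (b - x ^ N * b') \<in> ?Q"
        by (intro gen_ideal_diff ab(3) gen_ideal_mult_right [OF ab(2) a'(3)] gen_ideal_mult [OF _ b'(3)])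
           (simp add: a' x(1))
      also have "a * b - (a - x ^ M * a') * b - x ^ M * a' * (b - x ^ N * b') = x ^ (M + N) * (a' * b')"
        by (simp add: algebra_simps power_add)
      finally have "a' * b' \<in> ?Q"
        by (rule nonzerodivisor_mod_power [OF nzd x(1)]) (simp add: a' b')
      then have "a' * b' \<in> ?P"
        using subset_adjoin by blast
      with prime_inD [OF P this] a' b' show False by blast
    qed
  qed
qed

text \<open>
  Specialisation of one variable \<open>x\<close> to zero. The family \<open>f\<close> over \<open>k[X, x]\<close>
  specialises to the family \<open>g\<close> over \<open>k[X]\<close>.
\<close>

context
  fixes X :: "'x set" and x :: 'x and f :: "'i \<Rightarrow> ('x, 'k::comm_ring_1) mpoly" and I :: "'i set"
  assumes x: "x \<notin> X" and fin: "finite I"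
    and f: "\<And>i. i \<in> I \<Longrightarrow> f i \<in> polys (insert x X)" "\<And>i. i \<in> I \<Longrightarrow> quadric (f i)"
begin

private abbreviation (input) "g \<equiv> \<lambda>i. retract X (f i)"
private abbreviation (input) "Y \<equiv> insert x X"

lemma polys_X_Y: "p \<in> polys X \<Longrightarrow> p \<in> polys Y"
  by (rule polys_mono [OF subset_insertI])

lemma retract_gen_ideal:
  assumes "p \<in> gen_ideal Y f I"
  shows "retract X p \<in> gen_ideal X g I"
proof -
  obtain c where "p = (\<Sum>i\<in>I. c i * f i)"
    using assms unfolding gen_ideal_def by blast
  then have "retract X p = (\<Sum>i\<in>I. retract X (c i) * g i)"
    by (simp only: retract.hom_sum retract.hom_mult)
  then show ?thesis
    by (simp only:) (rule gen_idealI, simp)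
qed

lemma retract_x: "retract X (mvar x) = 0"
  using x by (simp add: retract_mvar)

text \<open>
  If the specialisation of \<open>c\<close> is a syzygy of \<open>g\<close>, it is Koszul, and the same alternating matrix applied
  to \<open>f\<close> agrees with \<open>c\<close> up to a multiple of \<open>x\<close>.
\<close>

lemma lift_koszul:
  assumes ac: "koszul_acyclic X g I"
    and c: "\<And>i. i \<in> I \<Longrightarrow> c i \<in> polys Y" "(\<Sum>i\<in>I. retract X (c i) * g i) = 0"
  obtains K c' where "alternating Y I K" "\<And>i. i \<in> I \<Longrightarrow> c' i \<in> polys Y"
    "\<And>i. i \<in> I \<Longrightarrow> c i - (\<Sum>j\<in>I. K i j * f j) = mvar x * c' i"
proof -
  have "syzygy X g I (\<lambda>i. retract X (c i))"
    using c(2) by (simp add: syzygy_def)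
  then obtain K where K: "alternating X I K"
    "\<And>i. i \<in> I \<Longrightarrow> retract X (c i) = (\<Sum>j\<in>I. K i j * g j)"
    using koszul_acyclicD [OF ac] by blast
  have KY: "alternating Y I K"
    using K(1) polys_X_Y by (auto simp: alternating_def)
  have "\<exists>q\<in>polys Y. c i - (\<Sum>j\<in>I. K i j * f j) = mvar x * q" if i: "i \<in> I" for i
  proof -
    have "retract X (c i - (\<Sum>j\<in>I. K i j * f j)) = (\<Sum>j\<in>I. K i j * g j) - (\<Sum>j\<in>I. retract X (K i j) * g j)"
      by (simp only: retract.hom_diff retract.hom_sum retract.hom_mult K(2) [OF i])
    also have "(\<Sum>j\<in>I. retract X (K i j) * g j) = (\<Sum>j\<in>I. K i j * g j)"
      by (intro sum.cong refl) (simp add: retract_id alternatingD(1) [OF K(1) i])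
    finally have "retract X (c i - (\<Sum>j\<in>I. K i j * f j)) = 0"
      by simp
    moreover have "c i - (\<Sum>j\<in>I. K i j * f j) \<in> polys Y"
      by (intro polys_diff polys_sum polys_mult c(1) [OF i] f(1) alternatingD(1) [OF KY i])
    ultimately show ?thesis
      using polys_insert_decompose [OF _ x, of "c i - (\<Sum>j\<in>I. K i j * f j)"] by auto
  qed
  then obtain c' where "\<And>i. i \<in> I \<Longrightarrow> c' i \<in> polys Y"
    "\<And>i. i \<in> I \<Longrightarrow> c i - (\<Sum>j\<in>I. K i j * f j) = mvar x * c' i"
    by metis
  with KY show ?thesis by (rule that)
qed

lemma lift_koszul_sum:
  assumes "alternating Y I K"
    and "\<And>i. i \<in> I \<Longrightarrow> c i - (\<Sum>j\<in>I. K i j * f j) = mvar x * c' i"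
  shows "(\<Sum>i\<in>I. c i * f i) = mvar x * (\<Sum>i\<in>I. c' i * f i)"
proof -
  have "(\<Sum>i\<in>I. c i * f i) = (\<Sum>i\<in>I. (c i - (\<Sum>j\<in>I. K i j * f j)) * f i)"
    using alternating_sum_eq_0 [OF fin assms(1), of f] by (simp add: left_diff_distrib sum_subtractf)
  also have "\<dots> = (\<Sum>i\<in>I. mvar x * (c' i * f i))"
    by (intro sum.cong refl) (simp add: assms(2) mult.assoc)
  finally show ?thesis by (simp add: sum_distrib_left)
qed

text \<open>
  A syzygy of \<open>f\<close> is a Koszul one plus \<open>x\<close> times another syzygy, because \<open>x\<close> can be cancelled in the
  polynomial ring; iterate.
\<close>

lemma koszul_acyclic_lift:
  assumes ac: "koszul_acyclic X g I"
  shows "koszul_acyclic Y f I"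
  unfolding koszul_acyclic_def
proof (intro allI impI)
  fix c assume c: "syzygy Y f I c"
  define Z where "Z t c \<longleftrightarrow> (\<exists>b. syzygy Y f I b \<and> (\<forall>i\<in>I. c i = mvar x ^ t * b i))" for t c
  show "koszul Y f I c"
  proof (rule koszul_if_approximable [where Z = Z])
    show "Z 0 c"
      unfolding Z_def using c by (intro exI [of _ c]) simp
  next
    fix t c assume "Z t c"
    then obtain b where b: "syzygy Y f I b" "\<And>i. i \<in> I \<Longrightarrow> c i = mvar x ^ t * b i"
      unfolding Z_def by blast
    then have bY: "\<And>i. i \<in> I \<Longrightarrow> b i \<in> polys Y" "(\<Sum>i\<in>I. b i * f i) = 0"
      by (auto simp: syzygy_def)
    have "(\<Sum>i\<in>I. retract X (b i) * g i) = retract X (\<Sum>i\<in>I. b i * f i)"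
      by (simp only: retract.hom_sum retract.hom_mult)
    also have "\<dots> = 0"
      by (simp only: bY(2) retract.hom_zero)
    finally obtain K c' where K: "alternating Y I K" "\<And>i. i \<in> I \<Longrightarrow> c' i \<in> polys Y"
      "\<And>i. i \<in> I \<Longrightarrow> b i - (\<Sum>j\<in>I. K i j * f j) = mvar x * c' i"
      using lift_koszul [OF ac, of b] bY(1) by blast
    have "mvar x * (\<Sum>i\<in>I. c' i * f i) = 0"
      using lift_koszul_sum [OF K(1,3)] bY(2) by simp
    then have syz: "syzygy Y f I c'"
      using K(2) mvar_mult_eq_0 by (auto simp: syzygy_def)
    have "c i - (\<Sum>j\<in>I. (mvar x ^ t * K i j) * f j) = mvar x ^ Suc t * c' i" if "i \<in> I" for i
    proof -
      have "(\<Sum>j\<in>I. (mvar x ^ t * K i j) * f j) = mvar x ^ t * (\<Sum>j\<in>I. K i j * f j)"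
        by (simp only: sum_distrib_left mult.assoc)
      then have "c i - (\<Sum>j\<in>I. (mvar x ^ t * K i j) * f j) =
          mvar x ^ t * (b i - (\<Sum>j\<in>I. K i j * f j))"
        by (simp only: b(2) [OF that] right_diff_distrib)
      then show ?thesis
        by (simp only: K(3) [OF that] power_Suc2 mult.assoc)
    qed
    moreover have "alternating Y I (\<lambda>i j. mvar x ^ t * K i j)"
      by (rule alternating_scale [OF _ K(1)]) simp
    ultimately show "\<exists>K. alternating Y I K \<and> Z (Suc t) (\<lambda>i. c i - (\<Sum>j\<in>I. K i j * f j))"
      using syz unfolding Z_def
      by (intro exI [of _ "\<lambda>i j. mvar x ^ t * K i j"] exI [of _ c'] conjI) auto
  next
    fix t c i assume "Z t c" "i \<in> I"
    then obtain b where "c i = mvar x ^ t * b i" unfolding Z_def by blast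
    moreover have "mvar x ^ t \<in> deg_ge t"
      by (intro deg_ge_power mvar_deg_ge_1)
    ultimately show "c i \<in> deg_ge t"
      using deg_ge_mult_right [of "mvar x ^ t" t "b i"] by (simp add: mult.commute)
  qed (use fin f in auto)
qed

text \<open>
  Modulo \<open>x\<close>, the ideal of \<open>f\<close> becomes the prime ideal of \<open>g\<close>. Koszul acyclicity makes \<open>x\<close> a
  nonzerodivisor modulo \<open>f\<close>.
\<close>

lemma prime_in_lift:
  assumes ac: "koszul_acyclic X g I" and P: "prime_in X (gen_ideal X g I)"
  shows "prime_in Y (gen_ideal Y f I)"
proof (rule prime_in_if_prime_adjoin [OF fin f(2)])
  let ?Q = "gen_ideal Y f I"
  show "nonzerodivisor_mod Y (mvar x) ?Q"
    unfolding nonzerodivisor_mod_def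
  proof (intro ballI impI)
    fix a assume a: "a \<in> polys Y" "mvar x * a \<in> ?Q"
    then obtain c where c: "\<And>i. i \<in> I \<Longrightarrow> c i \<in> polys Y" "mvar x * a = (\<Sum>i\<in>I. c i * f i)"
      unfolding gen_ideal_def by blast
    have "(\<Sum>i\<in>I. retract X (c i) * g i) = retract X (\<Sum>i\<in>I. c i * f i)"
      by (simp only: retract.hom_sum retract.hom_mult)
    also have "\<dots> = 0"
      by (simp only: c(2) [symmetric] retract.hom_mult retract_x mult_zero_left)
    finally obtain K c' where K: "alternating Y I K" "\<And>i. i \<in> I \<Longrightarrow> c' i \<in> polys Y"
      "\<And>i. i \<in> I \<Longrightarrow> c i - (\<Sum>j\<in>I. K i j * f j) = mvar x * c' i"
      using lift_koszul [OF ac, of c] c(1) by blast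
    have "mvar x * (a - (\<Sum>i\<in>I. c' i * f i)) = 0"
      using lift_koszul_sum [OF K(1,3)] c(2) by (simp add: right_diff_distrib)
    then have "a = (\<Sum>i\<in>I. c' i * f i)"
      using mvar_mult_eq_0 by fastforce
    then show "a \<in> ?Q"
      using gen_idealI [of I c' Y f] K(2) by simp
  qed
  have lift: "a \<in> adjoin Y ?Q (mvar x)" if a: "a \<in> polys Y" "retract X a \<in> gen_ideal X g I" for a
  proof -
    obtain c where c: "\<And>i. i \<in> I \<Longrightarrow> c i \<in> polys X" "retract X a = (\<Sum>i\<in>I. c i * g i)"
      using a(2) unfolding gen_ideal_def by blast
    obtain a' where a': "a' \<in> polys Y" "a = retract X a + mvar x * a'"
      using polys_insert_decompose [OF a(1) x] by blast
    have "\<forall>i\<in>I. \<exists>h\<in>polys Y. f i = g i + mvar x * h"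
      using polys_insert_decompose [OF f(1) x] by metis
    then obtain h where h: "\<And>i. i \<in> I \<Longrightarrow> h i \<in> polys Y" "\<And>i. i \<in> I \<Longrightarrow> f i = g i + mvar x * h i"
      by metis
    have "(\<Sum>i\<in>I. c i * g i) = (\<Sum>i\<in>I. c i * f i - mvar x * (c i * h i))"
    proof (intro sum.cong refl)
      fix i assume "i \<in> I"
      from h(2) [OF this] have "g i = f i - mvar x * h i"
        unfolding eq_diff_eq by (rule sym)
      then show "c i * g i = c i * f i - mvar x * (c i * h i)"
        by (simp only: right_diff_distrib mult.left_commute)
    qed
    then have "a = (\<Sum>i\<in>I. c i * f i) + mvar x * (a' - (\<Sum>i\<in>I. c i * h i))"
      using a'(2) c(2) by (simp add: sum_subtractf sum_distrib_left right_diff_distrib)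
    moreover have "(\<Sum>i\<in>I. c i * f i) \<in> ?Q"
      by (rule gen_idealI) (rule polys_X_Y, rule c(1))
    moreover have "a' - (\<Sum>i\<in>I. c i * h i) \<in> polys Y"
      using a'(1) h(1) polys_X_Y [OF c(1)] by (intro polys_diff polys_sum polys_mult)
    ultimately show ?thesis
      unfolding adjoin_def by blast
  qed
  have retr: "retract X a \<in> gen_ideal X g I" if "a \<in> adjoin Y ?Q (mvar x)" for a
  proof -
    obtain q b where q: "q \<in> ?Q" "a = q + mvar x * b"
      using \<open>a \<in> adjoin Y ?Q (mvar x)\<close> unfolding adjoin_def by blast
    have "retract X a = retract X q"
      by (simp add: q(2) retract.hom_add retract.hom_mult retract_x)
    then show ?thesis using retract_gen_ideal [OF q(1)] by simp
  qed
  show "prime_in Y (adjoin Y ?Q (mvar x))"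
    unfolding prime_in_def
  proof (intro conjI ballI impI notI)
    assume "1 \<in> adjoin Y ?Q (mvar x)"
    from retr [OF this] P show False by (simp add: retract.hom_one prime_in_def)
  next
    fix a b assume ab: "a \<in> polys Y" "b \<in> polys Y" "a * b \<in> adjoin Y ?Q (mvar x)"
    have "retract X a * retract X b \<in> gen_ideal X g I"
      using retr [OF ab(3)] by (simp only: retract.hom_mult)
    from prime_inD [OF P this] show "a \<in> adjoin Y ?Q (mvar x) \<or> b \<in> adjoin Y ?Q (mvar x)"
      using lift ab(1,2) retract_in_polys by blast
  qed
qed (rule mvar_deg_ge_1 | simp)+

end

section \<open>Edge polynomials\<close>

text \<open>
  The product over the edge makes the polynomial a function of the edge as a set, so that the generators form a
  family indexed by \<open>E\<close>.
\<close>

definition edge_poly :: "nat \<Rightarrow> 'v set \<Rightarrow> ('v \<times> nat, 'k::comm_ring_1) mpoly" where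
  "edge_poly d e = (\<Sum>l = 1..d. \<Prod>v\<in>e. mvar (v, l))"

lemma edge_poly_doubleton: "i \<noteq> j \<Longrightarrow> edge_poly d {i, j} = (\<Sum>l = 1..d. mvar (i, l) * mvar (j, l))"
  by (simp add: edge_poly_def)

lemma quadric_mvar_mult: "quadric (mvar x * mvar y)"
  using deg_ge_mult [OF mvar_deg_ge_1 mvar_deg_ge_1, of x y] deg_le_mult [OF mvar_deg_le_1 mvar_deg_le_1, of x y]
  unfolding quadric_def one_add_one by blast

lemma quadric_sum: "(\<And>i. i \<in> I \<Longrightarrow> quadric (g i)) \<Longrightarrow> quadric (\<Sum>i\<in>I. g i)"
  by (simp add: quadric_def)

lemma quadric_edge_poly: "card e = 2 \<Longrightarrow> quadric (edge_poly d e)"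
  unfolding card_2_iff by (auto simp: edge_poly_doubleton intro!: quadric_sum quadric_mvar_mult)

lemma edge_poly_in_polys: "e \<subseteq> V \<Longrightarrow> edge_poly d e \<in> polys (V \<times> {1..d})"
  unfolding edge_poly_def by (intro polys_sum polys_prod polys_mvar) auto

text \<open>
  Fraction-free elimination in place of minors. Let \<open>a\<close> be a square matrix that becomes the
  identity under \<open>h\<close>. For every set \<open>B\<close> of rows and \<open>j\<close> outside it, there is a vector orthogonal to these rows that becomes
  the unit vector \<open>e\<^sub>j\<close> under \<open>h\<close>; its product with row \<open>j\<close> then becomes 1.
\<close>

lemma cramer_elimination:
  fixes a :: "'i \<Rightarrow> 'i \<Rightarrow> ('x, 'k::comm_ring_1) mpoly" and h :: "('x, 'k) mpoly \<Rightarrow> 'r::comm_ring_1"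
  assumes "finite U" and hom: "unital_hom h"
    and a: "\<And>b i. b \<in> U \<Longrightarrow> i \<in> U \<Longrightarrow> a b i \<in> polys X"
    and ha: "\<And>b i. b \<in> U \<Longrightarrow> i \<in> U \<Longrightarrow> h (a b i) = (if b = i then 1 else 0)"
    and "finite B" "B \<subseteq> U" "j \<in> U - B"
  shows "\<exists>v. (\<forall>i\<in>U. v i \<in> polys X \<and> h (v i) = (if i = j then 1 else 0)) \<and>
    (\<forall>b\<in>B. (\<Sum>i\<in>U. a b i * v i) = 0)"
proof -
  interpret h: unital_hom h by (rule hom)
  show ?thesis
    using assms(5-7)
  proof (induction B arbitrary: j)
    case empty
    show ?case
      by (intro exI [of _ "\<lambda>i. if i = j then 1 else 0"]) (simp add: h.hom_one h.hom_zero)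
  next
    case (insert b B)
    obtain v where v: "\<And>i. i \<in> U \<Longrightarrow> v i \<in> polys X" "\<And>i. i \<in> U \<Longrightarrow> h (v i) = (if i = j then 1 else 0)"
      "\<And>c. c \<in> B \<Longrightarrow> (\<Sum>i\<in>U. a c i * v i) = 0"
      using insert.IH [of j] insert.prems by blast
    obtain w where w: "\<And>i. i \<in> U \<Longrightarrow> w i \<in> polys X" "\<And>i. i \<in> U \<Longrightarrow> h (w i) = (if i = b then 1 else 0)"
      "\<And>c. c \<in> B \<Longrightarrow> (\<Sum>i\<in>U. a c i * w i) = 0"
      using insert.IH [of b] insert.prems insert.hyps by blast
    \<comment> \<open>Eliminate row \<open>b\<close> from the vector for \<open>j\<close> using the vector for \<open>b\<close>; the pivot \<open>\<alpha>\<close> becomes 1 under \<open>h\<close>.\<close>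
    define \<alpha> where "\<alpha> = (\<Sum>i\<in>U. a b i * w i)"
    define \<beta> where "\<beta> = (\<Sum>i\<in>U. a b i * v i)"
    have b: "b \<in> U" "j \<in> U" "b \<noteq> j" using insert.prems by auto
    have polys: "\<alpha> \<in> polys X" "\<beta> \<in> polys X"
      using a b v w by (auto simp: \<alpha>_def \<beta>_def intro!: polys_sum polys_mult)
    have "h \<alpha> = (\<Sum>i\<in>U. if i = b then 1 else 0)"
      unfolding \<alpha>_def h.hom_sum h.hom_mult
      by (intro sum.cong refl) (simp add: ha b w)
    then have h\<alpha>: "h \<alpha> = 1" using b assms(1) by simp
    have "h \<beta> = (\<Sum>i\<in>U. 0)"
      unfolding \<beta>_def h.hom_sum h.hom_mult
      by (intro sum.cong refl) (use b in \<open>simp add: ha v\<close>)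
    then have h\<beta>: "h \<beta> = 0" by simp
    have sum: "(\<Sum>i\<in>U. a c i * (\<alpha> * v i - \<beta> * w i)) =
        \<alpha> * (\<Sum>i\<in>U. a c i * v i) - \<beta> * (\<Sum>i\<in>U. a c i * w i)" for c
      by (simp only: right_diff_distrib sum_subtractf sum_distrib_left mult.left_commute)
    show ?case
    proof (intro exI [of _ "\<lambda>i. \<alpha> * v i - \<beta> * w i"] conjI ballI)
      fix i assume "i \<in> U"
      then show "\<alpha> * v i - \<beta> * w i \<in> polys X" "h (\<alpha> * v i - \<beta> * w i) = (if i = j then 1 else 0)"
        using polys v(1) w(1) by (simp_all add: h.hom_diff h.hom_mult h\<alpha> h\<beta> v(2))
    next
      fix c assume "c \<in> insert b B"
      then show "(\<Sum>i\<in>U. a c i * (\<alpha> * v i - \<beta> * w i)) = 0"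
        unfolding sum using v(3) w(3) mult.commute [of \<alpha> \<beta>]
        by (auto simp flip: \<alpha>_def \<beta>_def)
    qed
  qed
qed

text \<open>
  Evaluation at the configuration that puts distinct standard basis vectors at the vertices of \<open>N\<close> (if \<open>\<pi>\<close> is
  injective) and zero at all others. Distinct vertices carry orthogonal vectors, so this is a zero of
  all edge polynomials; it serves to show that determinant-like polynomials are not in the ideal.
\<close>

definition frame_point :: "'v set \<Rightarrow> ('v \<Rightarrow> nat) \<Rightarrow> ('v \<times> nat, 'k::comm_ring_1) mpoly \<Rightarrow> 'k" where
  "frame_point N \<pi> = subst (\<lambda>c. c) (\<lambda>(u, l). if u \<in> N \<and> l = \<pi> u then 1 else 0)"

lemma unital_hom_frame_point: "unital_hom (frame_point N \<pi>)"
  unfolding frame_point_def by (rule unital_hom.subst_hom [OF unital_hom_id])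

lemma frame_point_mvar: "frame_point N \<pi> (mvar (u, l)) = (if u \<in> N \<and> l = \<pi> u then 1 else 0)"
  by (simp add: frame_point_def unital_hom.subst_mvar [OF unital_hom_id])

lemma frame_point_gen_ideal_eq_0:
  fixes p :: "('v \<times> nat, 'k::comm_ring_1) mpoly"
  assumes "inj_on \<pi> N" "\<And>e. e \<in> E \<Longrightarrow> card e = 2" "p \<in> gen_ideal X (edge_poly d) E"
  shows "frame_point N \<pi> p = 0"
proof -
  let ?h = "frame_point N \<pi> :: ('v \<times> nat, 'k) mpoly \<Rightarrow> 'k"
  interpret h: unital_hom ?h by (rule unital_hom_frame_point)
  have "?h (edge_poly d e) = 0" if "e \<in> E" for e
  proof -
    obtain u v where e: "e = {u, v}" "u \<noteq> v"
      using assms(2) [OF \<open>e \<in> E\<close>] by (auto simp: card_2_iff)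
    have "?h (mvar (u, l)) * ?h (mvar (v, l)) = 0" for l
      using e(2) inj_onD [OF assms(1), of u v] by (auto simp: frame_point_mvar)
    then show ?thesis
      by (simp only: e edge_poly_doubleton [OF e(2)] h.hom_sum h.hom_mult sum.neutral_const)
  qed
  moreover obtain c where "p = (\<Sum>e\<in>E. c e * edge_poly d e)"
    using assms(3) unfolding gen_ideal_def by blast
  ultimately show ?thesis
    by (simp add: h.hom_sum h.hom_mult)
qed

lemma simple_graph_edgeD: "simple_graph V E \<Longrightarrow> e \<in> E \<Longrightarrow> e \<subseteq> V" "simple_graph V E \<Longrightarrow> e \<in> E \<Longrightarrow> card e = 2"
  by (auto simp: simple_graph_def)

lemma simple_graph_finite_edges: "simple_graph V E \<Longrightarrow> finite E"
  by (rule finite_subset [of E "Pow V"]) (auto simp: simple_graph_def)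

section \<open>Removing an edge from a graph with prime ideal\<close>

locale lss_graph =
  fixes V :: "'v set" and E :: "'v set set" and d :: nat and X :: "('v \<times> nat) set"
  assumes graph: "simple_graph V E" and d: "d \<ge> 1"
  defines "X \<equiv> V \<times> {1..d}"
begin

lemma finite_E: "finite E"
  by (rule simple_graph_finite_edges [OF graph])

lemma edge: "e \<in> E \<Longrightarrow> e \<subseteq> V" "e \<in> E \<Longrightarrow> card e = 2"
  using simple_graph_edgeD [OF graph] by auto

lemma edge_poly_X: "e \<in> E \<Longrightarrow> edge_poly d e \<in> polys X"
  unfolding X_def by (intro edge_poly_in_polys edge)

lemma mvar_X: "u \<in> V \<Longrightarrow> l \<in> {1..d} \<Longrightarrow> mvar (u, l) \<in> polys X"
  unfolding X_def by (intro polys_mvar) auto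

definition nbrs :: "'v \<Rightarrow> 'v set" where
  "nbrs v = {u. {v, u} \<in> E}"

lemma nbrs: "u \<in> nbrs v \<Longrightarrow> u \<in> V" "u \<in> nbrs v \<Longrightarrow> u \<noteq> v" "u \<in> nbrs v \<Longrightarrow> {v, u} \<in> E"
  "u \<in> nbrs v \<Longrightarrow> v \<in> V"
  using edge [of "{v, u}"] by (auto simp: nbrs_def)

lemma finite_nbrs: "finite (nbrs v)"
  using finite_subset [of "nbrs v" V] nbrs graph by (auto simp: simple_graph_def)

text \<open>
  If \<open>v\<close> had \<open>d\<close> neighbours, then eliminating coordinates from their edge polynomials, which are linear forms in the
  \<open>d\<close> variables of \<open>v\<close>, would show that some \<open>g y\<^sub>v\<^sub>,\<^sub>l\<close> is in the ideal, where \<open>g\<close> does not vanish at a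
  zero of the ideal; and the ideal contains no linear form.
\<close>

lemma card_nbrs_less:
  assumes P: "prime_in X (gen_ideal X (edge_poly d) E :: ('v \<times> nat, 'k::field) mpoly set)"
  shows "card (nbrs v) < d"
proof (rule ccontr)
  let ?P = "gen_ideal X (edge_poly d) E :: ('v \<times> nat, 'k) mpoly set"
  assume "\<not> card (nbrs v) < d"
  then obtain D where D: "D \<subseteq> nbrs v" "card D = d"
    by (metis not_less obtain_subset_with_card_n)
  then have fin: "finite D" using d card_gt_0_iff [of D] by auto
  obtain \<pi> where \<pi>: "bij_betw \<pi> D {1..d}"
    using finite_same_card_bij [OF fin, of "{1..d}"] D(2) by auto
  obtain j where j: "j \<in> D" using d D(2) by fastforce
  let ?h = "frame_point D \<pi> :: ('v \<times> nat, 'k) mpoly \<Rightarrow> 'k"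
  interpret h: unital_hom ?h by (rule unital_hom_frame_point)
  have inj: "inj_on \<pi> D" using \<pi> by (rule bij_betw_imp_inj_on)
  have rng: "\<pi> i \<in> {1..d}" if "i \<in> D" for i
    using bij_betwE [OF \<pi>] that by blast
  have DV: "i \<in> V" "i \<noteq> v" "{v, i} \<in> E" "v \<in> V" if "i \<in> D" for i
    using nbrs [of i v] D(1) that by auto
  have "\<exists>w. (\<forall>i\<in>D. w i \<in> polys X \<and> ?h (w i) = (if i = j then 1 else 0)) \<and>
      (\<forall>b\<in>D - {j}. (\<Sum>i\<in>D. mvar (i, \<pi> b) * w i) = 0)"
    by (rule cramer_elimination [OF fin unital_hom_frame_point])
       (use fin j inj in \<open>auto simp: frame_point_mvar inj_on_eq_iff intro!: mvar_X DV(1) rng\<close>)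
  then obtain w where w: "\<And>i. i \<in> D \<Longrightarrow> w i \<in> polys X"
    "\<And>i. i \<in> D \<Longrightarrow> ?h (w i) = (if i = j then 1 else 0)"
    "\<And>b. b \<in> D - {j} \<Longrightarrow> (\<Sum>i\<in>D. mvar (i, \<pi> b) * w i) = 0"
    by blast
  define g where "g = (\<Sum>i\<in>D. mvar (i, \<pi> j) * w i)"
  have "?h g = (\<Sum>i\<in>D. if i = j then 1 else 0)"
    unfolding g_def h.hom_sum h.hom_mult by (intro sum.cong refl) (simp add: w frame_point_mvar)
  then have hg: "?h g = 1" using fin j by simp
  have "(\<Sum>i\<in>D. w i * edge_poly d {v, i}) = (\<Sum>i\<in>D. \<Sum>l = 1..d. w i * (mvar (v, l) * mvar (i, l)))"
    by (intro sum.cong refl)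
       (simp add: edge_poly_doubleton [OF DV(2) [THEN not_sym]] sum_distrib_left)
  also have "\<dots> = (\<Sum>l = 1..d. mvar (v, l) * (\<Sum>i\<in>D. mvar (i, l) * w i))"
    by (subst sum.swap) (simp add: sum_distrib_left ac_simps)
  also have "\<dots> = (\<Sum>b\<in>D. mvar (v, \<pi> b) * (\<Sum>i\<in>D. mvar (i, \<pi> b) * w i))"
    by (rule sum.reindex_bij_betw [OF \<pi>, symmetric])
  also have "\<dots> = (\<Sum>b\<in>D. if b = j then mvar (v, \<pi> j) * g else 0)"
    by (intro sum.cong refl) (auto simp: g_def w(3))
  also have "\<dots> = mvar (v, \<pi> j) * g"
    using fin j by simp
  finally have "mvar (v, \<pi> j) * g = (\<Sum>i\<in>D. w i * edge_poly d {v, i})" ..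
  also have "\<dots> \<in> ?P"
    by (intro gen_ideal_sum gen_ideal_mult w(1) gen_ideal_base finite_E DV(3))
  finally have "mvar (v, \<pi> j) * g \<in> ?P" .
  moreover have "mvar (v, \<pi> j) \<in> polys X" "g \<in> polys X"
    unfolding g_def using j by (auto intro!: polys_sum polys_mult mvar_X DV rng w(1))
  ultimately have "mvar (v, \<pi> j) \<in> ?P \<or> g \<in> ?P"
    by (rule prime_inD [OF P])
  moreover have "g \<notin> ?P"
    using hg frame_point_gen_ideal_eq_0 [OF inj edge(2), of E g X d] by auto
  moreover have "?P \<subseteq> deg_ge 2"
    by (intro gen_ideal_quadrics_subset_deg_ge_2 quadric_edge_poly edge(2))
  moreover have "mvar (v, \<pi> j) \<notin> (deg_ge 2 :: ('v \<times> nat, 'k) mpoly set)"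
    by (simp add: deg_ge_def mvar_def total_deg_def)
  ultimately show False by blast
qed

text \<open>
  The substitution \<open>y\<^sub>v \<mapsto> y\<^sub>v + t w\<close>, with values in the univariate polynomials in \<open>t\<close>.
\<close>

definition shift ::
  "'v \<Rightarrow> (nat \<Rightarrow> ('v \<times> nat, 'k::comm_ring_1) mpoly) \<Rightarrow> ('v \<times> nat, 'k) mpoly \<Rightarrow> ('v \<times> nat, 'k) mpoly poly" where
  "shift v w = subst (\<lambda>c. [:const c:]) (\<lambda>(u, l). if u = v then [:mvar (v, l), w l:] else [:mvar (u, l):])"

lemma unital_hom_const_poly: "unital_hom (\<lambda>c. [:const c:])"
  by (rule unital_hom_comp [OF unital_hom_pCons unital_hom_const])

lemma unital_hom_shift: "unital_hom (shift v w)"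
  unfolding shift_def by (rule unital_hom.subst_hom [OF unital_hom_const_poly])

lemma shift_const: "shift v w (const c) = [:const c:]"
  by (simp add: shift_def unital_hom.subst_const [OF unital_hom_const_poly])

lemma shift_mvar: "shift v w (mvar (u, l)) = (if u = v then [:mvar (v, l), w l:] else [:mvar (u, l):])"
  by (simp add: shift_def unital_hom.subst_mvar [OF unital_hom_const_poly])

lemma coeff_shift_in_polys:
  assumes p: "p \<in> polys X" and w: "\<And>l. w l \<in> polys X"
  shows "coeff (shift v w p) n \<in> polys X"
  using p
proof (induction arbitrary: n rule: polys_induct)
  case (const c)
  show ?case by (simp add: shift_const coeff_pCons split: nat.split)
next
  case (mvar x)
  then show ?case
    using w by (cases x) (auto simp: shift_mvar coeff_pCons split: nat.split)
next
  case (add p q)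
  then show ?case
    by (simp add: unital_hom.hom_add [OF unital_hom_shift])
next
  case (mult p q)
  then show ?case
    by (auto simp: unital_hom.hom_mult [OF unital_hom_shift] coeff_mult intro!: polys_sum polys_mult)
qed

lemma coeff_shift_0: "coeff (shift v w p) 0 = p"
  using in_polys_UNIV [of p]
proof (induction rule: polys_induct)
  case (mvar x)
  then show ?case by (cases x) (auto simp: shift_mvar)
qed (simp_all add: shift_const unital_hom.hom_add [OF unital_hom_shift]
      unital_hom.hom_mult [OF unital_hom_shift] coeff_mult)

lemma shift_edge_poly:
  fixes w :: "nat \<Rightarrow> ('v \<times> nat, 'k::comm_ring_1) mpoly"
  assumes "e \<in> E" "v \<notin> e"
  shows "shift v w (edge_poly d e) = [:edge_poly d e:]"
proof -
  interpret h: unital_hom "shift v w" by (rule unital_hom_shift)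
  interpret p: unital_hom "\<lambda>c::('v \<times> nat, 'k) mpoly. [:c:]" by (rule unital_hom_pCons)
  show ?thesis
    unfolding edge_poly_def h.hom_sum h.hom_prod p.hom_sum p.hom_prod
    using assms(2) by (intro sum.cong prod.cong refl) (auto simp: shift_mvar)
qed

lemma shift_edge_poly_incident:
  fixes w :: "nat \<Rightarrow> ('v \<times> nat, 'k::comm_ring_1) mpoly"
  assumes "u \<noteq> v"
  shows "shift v w (edge_poly d {v, u}) = [:edge_poly d {v, u}, \<Sum>l = 1..d. mvar (u, l) * w l:]"
proof -
  interpret h: unital_hom "shift v w" by (rule unital_hom_shift)
  have sum: "(\<Sum>l\<in>L. [:a l, b l:]) = [:\<Sum>l\<in>L. a l, \<Sum>l\<in>L. b l:]"
    for L :: "nat set" and a b :: "nat \<Rightarrow> ('v \<times> nat, 'k) mpoly"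
    by (induction L rule: infinite_finite_induct) simp_all
  have "shift v w (edge_poly d {v, u}) = (\<Sum>l = 1..d. [:mvar (v, l) * mvar (u, l), mvar (u, l) * w l:])"
    using assms by (simp add: edge_poly_doubleton h.hom_sum h.hom_mult shift_mvar mult.commute)
  then show ?thesis
    using assms by (simp add: sum edge_poly_doubleton)
qed

text \<open>
  The ideal of \<open>J\<close> is stable under the shift, coefficientwise in \<open>t\<close>. From \<open>f z \<in> Q\<close> it follows
  that \<open>(f + s t) u(t)\<close> has coefficients in \<open>Q\<close>, where \<open>u(t)\<close> is the shift of \<open>z\<close>. Descending from
  the top coefficient, each coefficient of \<open>u\<close> is multiplied into \<open>Q\<close> by a power of \<open>s\<close>; the last one
  is \<open>u(0) = z\<close>.
\<close>

lemma saturation_by_shift: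
  fixes w :: "nat \<Rightarrow> ('v \<times> nat, 'k::comm_ring_1) mpoly"
  assumes J: "J \<subseteq> E" and w: "\<And>l. w l \<in> polys X"
    and orth: "\<And>u. {v, u} \<in> J \<Longrightarrow> (\<Sum>l = 1..d. mvar (u, l) * w l) = 0"
    and j: "j \<noteq> v" "{v, j} \<in> E" and s: "s = (\<Sum>l = 1..d. mvar (j, l) * w l)" "s \<in> polys X"
    and z: "z \<in> polys X" "edge_poly d {v, j} * z \<in> gen_ideal X (edge_poly d) J"
  shows "\<exists>N. s ^ N * z \<in> gen_ideal X (edge_poly d) J"
proof -
  let ?Q = "gen_ideal X (edge_poly d) J"
  interpret h: unital_hom "shift v w" by (rule unital_hom_shift)
  have gen: "shift v w (edge_poly d e) = [:edge_poly d e:]" if "e \<in> J" for e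
  proof (cases "v \<in> e")
    case True
    have "card e = 2" using edge J that by blast
    then obtain u where u: "e = {v, u}" "u \<noteq> v"
      using True by (auto simp: card_2_iff doubleton_eq_iff)
    then show ?thesis
      using orth [of u] that by (simp add: shift_edge_poly_incident [OF u(2)])
  next
    case False
    then show ?thesis using shift_edge_poly J that by blast
  qed
  have stable: "coeff (shift v w q) n \<in> ?Q" if "q \<in> ?Q" for q n
  proof -
    obtain c where c: "\<And>e. e \<in> J \<Longrightarrow> c e \<in> polys X" "q = (\<Sum>e\<in>J. c e * edge_poly d e)"
      using \<open>q \<in> ?Q\<close> unfolding gen_ideal_def by blast
    have "coeff (shift v w q) n = (\<Sum>e\<in>J. coeff (shift v w (c e)) n * edge_poly d e)"
      unfolding c(2) h.hom_sum h.hom_mult coeff_sum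
      by (intro sum.cong refl) (simp add: gen mult.commute)
    also have "\<dots> \<in> ?Q"
      by (intro gen_idealI coeff_shift_in_polys c(1) w)
    finally show ?thesis .
  qed
  define u where "u = coeff (shift v w z)"
  have uX: "u n \<in> polys X" for n
    unfolding u_def by (intro coeff_shift_in_polys z w)
  let ?f = "edge_poly d {v, j}"
  have rec: "?f * u (Suc n) + s * u n \<in> ?Q" for n
  proof -
    have "coeff (shift v w (?f * z)) (Suc n) = coeff ([:?f, s:] * shift v w z) (Suc n)"
      by (simp only: h.hom_mult shift_edge_poly_incident [OF j(1)] s(1))
    also have "\<dots> = ?f * u (Suc n) + s * u n"
      by (simp add: u_def)
    finally show ?thesis
      using stable [OF z(2), of "Suc n"] by simp
  qed
  have "\<exists>N. s ^ N * u n \<in> ?Q" if "n \<le> Suc (degree (shift v w z))" for n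
    using that
  proof (induction rule: inc_induct)
    case base
    show ?case by (simp add: u_def coeff_eq_0)
  next
    case (step n)
    then obtain N where N: "s ^ N * u (Suc n) \<in> ?Q" by blast
    have "s ^ N * (?f * u (Suc n) + s * u n) - ?f * (s ^ N * u (Suc n)) \<in> ?Q"
      by (intro gen_ideal_diff gen_ideal_mult [OF polys_power [OF s(2)] rec] gen_ideal_mult [OF edge_poly_X [OF j(2)] N])
    then have "s ^ Suc N * u n \<in> ?Q"
      by (simp add: algebra_simps)
    then show ?case by blast
  qed
  from this [of 0] show ?thesis
    by (simp add: u_def coeff_shift_0)
qed

lemma remove_edge:
  assumes P: "prime_in X (gen_ideal X (edge_poly d) E :: ('v \<times> nat, 'k::field) mpoly set)" and e: "e \<in> E"
  shows "nonzerodivisor_mod X (edge_poly d e) (gen_ideal X (edge_poly d) (E - {e}) :: ('v \<times> nat, 'k) mpoly set)"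
    and "prime_in X (gen_ideal X (edge_poly d) (E - {e}) :: ('v \<times> nat, 'k) mpoly set)"
proof -
  let ?P = "gen_ideal X (edge_poly d) E :: ('v \<times> nat, 'k) mpoly set"
  let ?Q = "gen_ideal X (edge_poly d) (E - {e}) :: ('v \<times> nat, 'k) mpoly set"
  obtain v j where vj: "e = {v, j}" "j \<noteq> v"
    using edge(2) [OF e] by (auto simp: card_2_iff)
  define N where "N = nbrs v"
  have jN: "j \<in> N" using vj e by (simp add: N_def nbrs_def)
  have fin: "finite N" by (simp add: N_def finite_nbrs)
  obtain \<pi> where \<pi>: "inj_on \<pi> N" "\<pi> ` N \<subseteq> {1..d}"
    using card_le_inj [OF fin, of "{1..d}"] card_nbrs_less [OF P, of v] by (auto simp: N_def)
  have rng: "\<pi> i \<in> {1..d}" if "i \<in> N" for i using that \<pi>(2) by blast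
  have NV: "i \<in> V" if "i \<in> N" for i using that nbrs(1) by (simp add: N_def)
  let ?h = "frame_point N \<pi> :: ('v \<times> nat, 'k) mpoly \<Rightarrow> 'k"
  interpret h: unital_hom ?h by (rule unital_hom_frame_point)
  have "\<exists>a. (\<forall>i\<in>N. a i \<in> polys X \<and> ?h (a i) = (if i = j then 1 else 0)) \<and>
      (\<forall>b\<in>N - {j}. (\<Sum>i\<in>N. mvar (b, \<pi> i) * a i) = 0)"
    by (rule cramer_elimination [OF fin unital_hom_frame_point])
       (use fin jN \<pi>(1) in \<open>auto simp: frame_point_mvar inj_on_eq_iff intro!: mvar_X NV rng\<close>)
  then obtain a where a: "\<And>i. i \<in> N \<Longrightarrow> a i \<in> polys X"
    "\<And>i. i \<in> N \<Longrightarrow> ?h (a i) = (if i = j then 1 else 0)"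
    "\<And>b. b \<in> N - {j} \<Longrightarrow> (\<Sum>i\<in>N. mvar (b, \<pi> i) * a i) = 0"
    by blast
  \<comment> \<open>The vector with coefficient \<open>a i\<close> in direction \<open>\<pi> i\<close>, for all neighbours \<open>i\<close>.\<close>
  define w where "w l = (\<Sum>i\<in>N. if \<pi> i = l then a i else 0)" for l
  have wX: "w l \<in> polys X" for l
    unfolding w_def using a(1) by (intro polys_sum) auto
  have pair: "(\<Sum>l = 1..d. mvar (u, l) * w l) = (\<Sum>i\<in>N. mvar (u, \<pi> i) * a i)" for u
  proof -
    have "(\<Sum>l = 1..d. mvar (u, l) * w l) = (\<Sum>i\<in>N. \<Sum>l = 1..d. if \<pi> i = l then mvar (u, l) * a i else 0)"
      unfolding w_def sum_distrib_left by (subst sum.swap) (intro sum.cong refl, simp)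
    also have "\<dots> = (\<Sum>i\<in>N. mvar (u, \<pi> i) * a i)"
      by (intro sum.cong refl) (use rng in simp)
    finally show ?thesis .
  qed
  define s where "s = (\<Sum>l = 1..d. mvar (j, l) * w l)"
  have sX: "s \<in> polys X"
    unfolding s_def using wX mvar_X NV [OF jN] by (intro polys_sum polys_mult) auto
  have "?h s = (\<Sum>i\<in>N. if i = j then 1 else 0)"
    unfolding s_def pair h.hom_sum h.hom_mult
    by (intro sum.cong refl) (use jN in \<open>simp add: a frame_point_mvar\<close>)
  then have "?h s = 1" using fin jN by simp
  then have sP: "s \<notin> ?P"
    using frame_point_gen_ideal_eq_0 [OF \<pi>(1) edge(2), of E s X d] by auto
  have P_eq: "adjoin X ?Q (edge_poly d e) = ?P"
    using gen_ideal_insert [of "E - {e}" e X "edge_poly d :: _ \<Rightarrow> ('v \<times> nat, 'k) mpoly"] finite_E e by (simp add: adjoin_def insert_absorb)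
  have orth: "(\<Sum>l = 1..d. mvar (u, l) * w l) = 0" if "{v, u} \<in> E - {e}" for u
    unfolding pair using that vj by (intro a(3)) (auto simp: N_def nbrs_def)
  have sat: "\<exists>M. s ^ M * z \<in> ?Q" if "z \<in> polys X" "edge_poly d e * z \<in> ?Q" for z
    by (rule saturation_by_shift [OF _ wX orth vj(2) _ s_def sX]) (use that e vj in auto)
  have Q: "finite (E - {e})" "\<And>e'. e' \<in> E - {e} \<Longrightarrow> quadric (edge_poly d e')"
    using finite_E edge(2) quadric_edge_poly by auto
  have x: "edge_poly d e \<in> polys X" "edge_poly d e \<in> deg_ge 1"
    by (rule edge_poly_X [OF e]) (rule quadric_deg_ge_1 [OF quadric_edge_poly [OF edge(2) [OF e]]])
  show nzd: "nonzerodivisor_mod X (edge_poly d e) ?Q"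
    by (rule nonzerodivisor_if_saturated [OF Q x _ sX _ sat]) (use P sP P_eq in auto)
  show "prime_in X ?Q"
    by (rule prime_in_if_prime_adjoin [OF Q x _ nzd]) (use P P_eq in auto)
qed

end

lemma lss_graph_subset: "lss_graph V E d \<Longrightarrow> E' \<subseteq> E \<Longrightarrow> lss_graph V E' d"
  by (auto simp: lss_graph_def simple_graph_def)

text \<open>
  Remove the edges one at a time; each is a nonzerodivisor modulo the remaining ones.
\<close>

lemma prime_imp_koszul_acyclic:
  assumes "lss_graph V E d"
    and "prime_in (V \<times> {1..d}) (gen_ideal (V \<times> {1..d}) (edge_poly d) E :: ('v \<times> nat, 'k::field) mpoly set)"
  shows "koszul_acyclic (V \<times> {1..d}) (edge_poly d :: _ \<Rightarrow> ('v \<times> nat, 'k) mpoly) E"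
proof -
  have "finite E" using lss_graph.finite_E [OF assms(1)] .
  then show ?thesis
    using assms
  proof (induction E rule: finite_remove_induct)
    case empty
    show ?case by (rule koszul_acyclic_empty)
  next
    case (remove E)
    then obtain e where e: "e \<in> E" by blast
    interpret lss_graph V E d "V \<times> {1..d}" by (rule remove.prems) simp
    note rem = remove_edge [OF remove.prems(2) e]
    have "koszul_acyclic (V \<times> {1..d}) (edge_poly d :: _ \<Rightarrow> ('v \<times> nat, 'k) mpoly) (E - {e})"
      using remove.IH [OF e] lss_graph_subset [OF remove.prems(1)] rem(2) by blast
    then have "koszul_acyclic (V \<times> {1..d}) (edge_poly d :: _ \<Rightarrow> ('v \<times> nat, 'k) mpoly) (insert e (E - {e}))"
      using remove.hyps edge_poly_X e rem(1) by (intro koszul_acyclic_insert) auto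
    then show ?case using e by (simp add: insert_absorb)
  qed
qed

lemma prime_imp_prime_subgraph:
  assumes "lss_graph V E d" "E' \<subseteq> E"
    and "prime_in (V \<times> {1..d}) (gen_ideal (V \<times> {1..d}) (edge_poly d) E :: ('v \<times> nat, 'k::field) mpoly set)"
  shows "prime_in (V \<times> {1..d}) (gen_ideal (V \<times> {1..d}) (edge_poly d) E' :: ('v \<times> nat, 'k) mpoly set)"
proof -
  have fin: "finite (E - E')" using lss_graph.finite_E [OF assms(1)] by simp
  have "prime_in (V \<times> {1..d}) (gen_ideal (V \<times> {1..d}) (edge_poly d) (E - D) :: ('v \<times> nat, 'k) mpoly set)"
    if "finite D" "D \<subseteq> E" for D
    using that
  proof (induction D)
    case (insert e D)
    interpret lss_graph V "E - D" d "V \<times> {1..d}"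
      by (rule lss_graph_subset [OF assms(1)]) auto
    have "E - insert e D = E - D - {e}" by blast
    then show ?case
      using remove_edge(2) [of e] insert by auto
  qed (use assms(3) in simp)
  from this [OF fin] assms(2) show ?thesis
    by (simp add: double_diff)
qed

section \<open>One more dimension\<close>

lemma koszul_acyclic_cong:
  assumes "\<And>i. i \<in> I \<Longrightarrow> f i = g i"
  shows "koszul_acyclic X f I \<longleftrightarrow> koszul_acyclic X g I"
  using assms by (simp add: koszul_acyclic_def koszul_def syzygy_def cong: sum.cong)

text \<open>
  Interpolates between \<open>edge_poly d\<close> and \<open>edge_poly (d + 1)\<close>: only the vertices in \<open>U\<close> have their
  last coordinate, and that of the other vertices is zero.
\<close>

definition partial_edge_poly :: "nat \<Rightarrow> 'v set \<Rightarrow> 'v set \<Rightarrow> ('v \<times> nat, 'k::comm_ring_1) mpoly" where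
  "partial_edge_poly d U e = edge_poly d e + (if e \<subseteq> U then \<Prod>v\<in>e. mvar (v, Suc d) else 0)"

lemma partial_edge_poly_in_polys:
  assumes "e \<subseteq> V"
  shows "partial_edge_poly d U e \<in> polys (V \<times> {1..d} \<union> U \<times> {Suc d})"
proof -
  have "edge_poly d e \<in> polys (V \<times> {1..d} \<union> U \<times> {Suc d})"
    by (rule polys_mono [OF Un_upper1 edge_poly_in_polys [OF assms]])
  then show ?thesis
    unfolding partial_edge_poly_def by (auto intro!: polys_add polys_prod polys_mvar)
qed

lemma quadric_add: "quadric p \<Longrightarrow> quadric q \<Longrightarrow> quadric (p + q)"
  by (simp add: quadric_def)

lemma quadric_partial_edge_poly: "card e = 2 \<Longrightarrow> quadric (partial_edge_poly d U e)"
  using quadric_mvar_mult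
  by (auto simp: partial_edge_poly_def quadric_edge_poly card_2_iff intro!: quadric_add)

lemma retract_partial_edge_poly:
  assumes "e \<subseteq> V" "finite e" "u \<notin> U"
  shows "retract (V \<times> {1..d} \<union> U \<times> {Suc d}) (partial_edge_poly d (insert u U) e) =
      (partial_edge_poly d U e :: ('v \<times> nat, 'k::comm_ring_1) mpoly)"
proof -
  define X where "X = V \<times> {1..d} \<union> U \<times> {Suc d}"
  let ?f = "edge_poly d e :: ('v \<times> nat, 'k) mpoly"
  let ?m = "(\<Prod>v\<in>e. mvar (v, Suc d)) :: ('v \<times> nat, 'k) mpoly"
  have f: "retract X ?f = ?f"
    unfolding X_def by (rule retract_id) (rule polys_mono [OF Un_upper1 edge_poly_in_polys [OF assms(1)]])
  have in_U: "retract X ?m = ?m" if "e \<subseteq> U"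
    using that by (intro retract_id polys_prod polys_mvar) (auto simp: X_def)
  have not_in_U: "retract X ?m = 0" if "\<not> e \<subseteq> U"
    using that assms(2) by (auto simp: X_def retract.hom_prod retract_mvar intro!: prod_zero)
  consider "e \<subseteq> U" | "\<not> e \<subseteq> U" "e \<subseteq> insert u U" | "\<not> e \<subseteq> insert u U"
    by blast
  then have "retract X (partial_edge_poly d (insert u U) e) = (partial_edge_poly d U e :: ('v \<times> nat, 'k) mpoly)"
  proof cases
    case 1
    then have "e \<subseteq> insert u U" by blast
    with 1 show ?thesis by (simp add: partial_edge_poly_def retract.hom_add f in_U)
  next
    case 2
    then show ?thesis
      by (simp add: partial_edge_poly_def retract.hom_add f not_in_U)
  next
    case 3
    then have "\<not> e \<subseteq> U" by blast
    with 3 show ?thesis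
      by (simp add: partial_edge_poly_def retract.hom_add retract.hom_zero f)
  qed
  then show ?thesis by (simp only: X_def)
qed

lemma increase_dimension:
  fixes V :: "'v set"
  assumes G: "simple_graph V E"
    and ac: "koszul_acyclic (V \<times> {1..d}) (edge_poly d :: _ \<Rightarrow> ('v \<times> nat, 'k::field) mpoly) E"
  shows "koszul_acyclic (V \<times> {1..Suc d}) (edge_poly (Suc d) :: _ \<Rightarrow> ('v \<times> nat, 'k) mpoly) E"
    and "prime_in (V \<times> {1..d}) (gen_ideal (V \<times> {1..d}) (edge_poly d) E :: ('v \<times> nat, 'k) mpoly set) \<Longrightarrow>
      prime_in (V \<times> {1..Suc d}) (gen_ideal (V \<times> {1..Suc d}) (edge_poly (Suc d)) E :: ('v \<times> nat, 'k) mpoly set)"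
proof -
  let ?p = "partial_edge_poly d :: _ \<Rightarrow> _ \<Rightarrow> ('v \<times> nat, 'k) mpoly"
  let ?X = "\<lambda>U. V \<times> {1..d} \<union> U \<times> {Suc d}"
  define Pr where "Pr \<longleftrightarrow> prime_in (V \<times> {1..d}) (gen_ideal (V \<times> {1..d}) (edge_poly d) E :: ('v \<times> nat, 'k) mpoly set)"
  have E: "finite E" "\<And>e. e \<in> E \<Longrightarrow> e \<subseteq> V" "\<And>e. e \<in> E \<Longrightarrow> card e = 2" "finite V"
    using simple_graph_finite_edges [OF G] simple_graph_edgeD [OF G] G by (auto simp: simple_graph_def)
  have "koszul_acyclic (?X U) (?p U) E \<and> (Pr \<longrightarrow> prime_in (?X U) (gen_ideal (?X U) (?p U) E))"
    if "finite U" for U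
    using that
  proof (induction U)
    case empty
    have "?p {} e = edge_poly d e" if "e \<in> E" for e
      using E(3) [OF that] by (auto simp: partial_edge_poly_def)
    then show ?case
      using ac koszul_acyclic_cong [of E "?p {}" "edge_poly d"] gen_ideal_cong [of E "?p {}" "edge_poly d"]
      by (simp add: Pr_def)
  next
    case (insert u U)
    have X: "insert (u, Suc d) (?X U) = ?X (insert u U)" by auto
    have x: "(u, Suc d) \<notin> ?X U" using insert.hyps by auto
    have r: "retract (?X U) (?p (insert u U) e) = ?p U e" if "e \<in> E" for e
      by (rule retract_partial_edge_poly [OF E(2) [OF that] finite_subset [OF E(2) [OF that] E(4)] insert.hyps(2)])
    have poly: "?p (insert u U) e \<in> polys (insert (u, Suc d) (?X U))" if "e \<in> E" for e
      unfolding X by (rule partial_edge_poly_in_polys [OF E(2) [OF that]])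
    have quad: "quadric (?p (insert u U) e)" if "e \<in> E" for e
      by (rule quadric_partial_edge_poly [OF E(3) [OF that]])
    have ac': "koszul_acyclic (?X U) (\<lambda>e. retract (?X U) (?p (insert u U) e)) E"
      by (rule koszul_acyclic_cong [OF r, THEN iffD2, OF _ conjunct1 [OF insert.IH]])
    have "koszul_acyclic (?X (insert u U)) (?p (insert u U)) E"
      using koszul_acyclic_lift [OF x E(1) poly quad ac'] unfolding X .
    moreover have "prime_in (?X (insert u U)) (gen_ideal (?X (insert u U)) (?p (insert u U)) E)" if Pr
    proof -
      have "prime_in (?X U) (gen_ideal (?X U) (\<lambda>e. retract (?X U) (?p (insert u U) e)) E)"
        by (subst gen_ideal_cong [OF r]) (use insert.IH that in simp_all)
      from prime_in_lift [OF x E(1) poly quad ac' this] show ?thesis unfolding X .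
    qed
    ultimately show ?case by blast
  qed
  note this [OF E(4)]
  moreover have "?X V = V \<times> {1..Suc d}" by auto
  moreover have full: "?p V e = edge_poly (Suc d) e" if "e \<in> E" for e
    using E(2) [OF that] by (simp add: partial_edge_poly_def edge_poly_def)
  ultimately show "koszul_acyclic (V \<times> {1..Suc d}) (edge_poly (Suc d) :: _ \<Rightarrow> ('v \<times> nat, 'k) mpoly) E"
    and "prime_in (V \<times> {1..d}) (gen_ideal (V \<times> {1..d}) (edge_poly d) E :: ('v \<times> nat, 'k) mpoly set) \<Longrightarrow>
      prime_in (V \<times> {1..Suc d}) (gen_ideal (V \<times> {1..Suc d}) (edge_poly (Suc d)) E :: ('v \<times> nat, 'k) mpoly set)"
    using koszul_acyclic_cong [of E "?p V" "edge_poly (Suc d)", OF full]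
      gen_ideal_cong [of E "?p V" "edge_poly (Suc d)", OF full]
    by (simp_all only: Pr_def simp_thms)
qed

section \<open>Restriction to fewer variables\<close>

lemma gen_ideal_restrict:
  assumes "\<And>i. i \<in> I \<Longrightarrow> f i \<in> polys X'" "p \<in> gen_ideal X f I" "p \<in> polys X'"
  shows "p \<in> gen_ideal X' f I"
proof -
  obtain c where "p = (\<Sum>i\<in>I. c i * f i)"
    using assms(2) unfolding gen_ideal_def by blast
  then have "retract X' p = (\<Sum>i\<in>I. retract X' (c i) * f i)"
    by (simp add: retract.hom_sum retract.hom_mult retract_id [OF assms(1)] cong: sum.cong)
  then show ?thesis
    using gen_idealI [of I "\<lambda>i. retract X' (c i)" X' f] by (simp add: retract_id [OF assms(3)])
qed

lemma gen_ideal_mono_vars: "X' \<subseteq> X \<Longrightarrow> gen_ideal X' f I \<subseteq> gen_ideal X f I"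
  unfolding gen_ideal_def using polys_mono by blast

lemma prime_in_restrict:
  assumes X: "X' \<subseteq> X" and f: "\<And>i. i \<in> I \<Longrightarrow> f i \<in> polys X'" and P: "prime_in X (gen_ideal X f I)"
  shows "prime_in X' (gen_ideal X' f I)"
  unfolding prime_in_def
proof (intro conjI ballI impI)
  show "1 \<notin> gen_ideal X' f I"
    using P gen_ideal_mono_vars [OF X] by (auto simp: prime_in_def)
next
  fix a b assume ab: "a \<in> polys X'" "b \<in> polys X'" "a * b \<in> gen_ideal X' f I"
  then have "a * b \<in> gen_ideal X f I" using gen_ideal_mono_vars [OF X] by blast
  from prime_inD [OF P this] have "a \<in> gen_ideal X f I \<or> b \<in> gen_ideal X f I"
    by (simp add: polys_mono [OF X] ab(1,2))
  then show "a \<in> gen_ideal X' f I \<or> b \<in> gen_ideal X' f I"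
    by (elim disj_forward) (rule gen_ideal_restrict [OF f], simp_all add: ab(1,2))+
qed

lemma koszul_acyclic_restrict:
  assumes X: "X' \<subseteq> X" and f: "\<And>i. i \<in> I \<Longrightarrow> f i \<in> polys X'" and ac: "koszul_acyclic X f I"
  shows "koszul_acyclic X' f I"
  unfolding koszul_acyclic_def
proof (intro allI impI)
  fix c assume c: "syzygy X' f I c"
  then have "syzygy X f I c"
    using polys_mono [OF X] by (auto simp: syzygy_def)
  then obtain K where K: "alternating X I K" "\<forall>i\<in>I. c i = (\<Sum>j\<in>I. K i j * f j)"
    using koszul_acyclicD [OF ac] by blast
  have "c i = (\<Sum>j\<in>I. retract X' (K i j) * f j)" if "i \<in> I" for i
  proof -
    have "retract X' (c i) = (\<Sum>j\<in>I. retract X' (K i j) * f j)"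
      using K(2) that by (simp add: retract.hom_sum retract.hom_mult retract_id [OF f] cong: sum.cong)
    then show ?thesis
      using c that by (simp add: syzygy_def retract_id)
  qed
  moreover have "alternating X' I (\<lambda>i j. retract X' (K i j))"
    using K(1) by (rule alternating_image) (simp_all add: retract.hom_zero retract.hom_add)
  ultimately show "koszul X' f I c"
    unfolding koszul_def by blast
qed

section \<open>Edge polynomials generate minimally\<close>

lemma constant_term_by_hom:
  fixes h :: "('x, 'k::comm_ring_1) mpoly \<Rightarrow> 'k"
  assumes "unital_hom h" "\<And>c. h (const c) = c" "\<And>x. h (mvar x) = 0"
  shows "p - const (h p) \<in> deg_ge 1"
proof -
  interpret h: unital_hom h by fact
  show ?thesis
    using in_polys_UNIV [of p]
  proof (induction rule: polys_induct)
    case (mvar x)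
    show ?case using mvar_deg_ge_1 [of x] by (simp only: assms(3) const_zero diff_zero)
  next
    case (add p q)
    then show ?case
      using deg_ge_add [OF add.IH] by (simp add: h.hom_add const_add algebra_simps)
  next
    case (mult p q)
    have "q * (p - const (h p)) + const (h p) * (q - const (h q)) \<in> deg_ge 1"
      by (intro deg_ge_add deg_ge_mult_right mult.IH)
    then show ?case
      by (simp add: h.hom_mult const_mult algebra_simps)
  qed (simp add: assms(2))
qed

text \<open>
  Linear independence of the edge polynomials. Send the first coordinates of the two ends of \<open>e\<close> to an
  indeterminate \<open>t\<close> and everything else to zero: \<open>f\<^sub>e\<close> becomes \<open>t\<^sup>2\<close>, and the other edge
  polynomials vanish. For \<open>d = 0\<close> all edge polynomials would be zero.
\<close>

lemma edge_poly_syzygy_deg_ge_1: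
  fixes c :: "'v set \<Rightarrow> ('v \<times> nat, 'k::field) mpoly"
  assumes G: "lss_graph V E d" and c: "syzygy X (edge_poly d) E c" and e: "e \<in> E"
  shows "c e \<in> deg_ge 1"
proof -
  interpret lss_graph V E d "V \<times> {1..d}" by (rule G) simp
  define \<phi> :: "'v \<times> nat \<Rightarrow> 'k poly" where "\<phi> = (\<lambda>(u, l). if u \<in> e \<and> l = 1 then [:0, 1:] else 0)"
  define h :: "('v \<times> nat, 'k) mpoly \<Rightarrow> 'k poly" where "h = subst (\<lambda>c. [:c:]) \<phi>"
  interpret h: unital_hom h
    unfolding h_def by (rule unital_hom.subst_hom [OF unital_hom_pCons])
  have var: "h (mvar (u, l)) = (if u \<in> e \<and> l = 1 then [:0, 1:] else 0)" for u l
    by (simp add: h_def \<phi>_def unital_hom.subst_mvar [OF unital_hom_pCons])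
  have h_edge: "h (edge_poly d e') = (if e' = e then [:0, 1:] * [:0, 1:] else 0)" if e': "e' \<in> E" for e'
  proof -
    obtain u v where uv: "e' = {u, v}" "u \<noteq> v"
      using edge(2) [OF e'] by (auto simp: card_2_iff)
    have iff: "u \<in> e \<and> v \<in> e \<longleftrightarrow> e' = e"
      using edge(2) [OF e] uv by (auto simp: card_2_iff)
    have "h (edge_poly d e') = (\<Sum>l = 1..d. if l = 1 then (if e' = e then [:0, 1:] * [:0, 1:] else 0) else 0)"
      unfolding uv(1) edge_poly_doubleton [OF uv(2)] h.hom_sum h.hom_mult var
      unfolding uv(1) [symmetric] using iff by (intro sum.cong refl) auto
    then show ?thesis using d by simp
  qed
  have "0 = h (\<Sum>e'\<in>E. c e' * edge_poly d e')"
    using c by (simp add: syzygy_def h.hom_zero)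
  also have "\<dots> = (\<Sum>e'\<in>E. if e' = e then h (c e) * ([:0, 1:] * [:0, 1:]) else 0)"
    unfolding h.hom_sum h.hom_mult by (intro sum.cong refl) (simp add: h_edge)
  also have "\<dots> = h (c e) * ([:0, 1:] * [:0, 1:])"
    using finite_E e by simp
  finally have "h (c e) = 0" by simp
  moreover have "c e - const (coeff (h (c e)) 0) \<in> deg_ge 1"
  proof (rule constant_term_by_hom [of "\<lambda>p. coeff (h p) 0"])
    show "unital_hom (\<lambda>p. coeff (h p) 0)"
      by unfold_locales (simp_all add: h.hom_one h.hom_add h.hom_mult coeff_mult)
    show "coeff (h (const a)) 0 = a" for a
      by (simp add: h_def unital_hom.subst_const [OF unital_hom_pCons])
    show "coeff (h (mvar x)) 0 = 0" for x
      by (cases x) (simp add: var)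
  qed
  ultimately show ?thesis by simp
qed

section \<open>Translation to ideals of rings with explicit carrier\<close>

lemma carrier_mpoly_ring: "carrier (mpoly_ring X) = polys X"
  by (simp add: polys_def)

lemma mpoly_ring_ops [simp]:
  "p \<oplus>\<^bsub>mpoly_ring X\<^esub> q = p + q" "p \<otimes>\<^bsub>mpoly_ring X\<^esub> q = p * q"
  "\<zero>\<^bsub>mpoly_ring X\<^esub> = 0" "\<one>\<^bsub>mpoly_ring X\<^esub> = 1"
  by (simp_all add: mpoly_ring_def)

lemma mpoly_ring_uminus:
  fixes p :: "('x, 'k::comm_ring_1) mpoly"
  assumes "p \<in> polys X"
  shows "\<ominus>\<^bsub>mpoly_ring X\<^esub> p = - p"
proof -
  interpret R: cring "mpoly_ring X :: ('x, 'k) mpoly ring" by (rule cring_mpoly_ring)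
  show ?thesis
    using assms by (intro R.minus_equality) (simp_all add: carrier_mpoly_ring)
qed

lemma ideal_gen_ideal:
  fixes f :: "'i \<Rightarrow> ('x, 'k::comm_ring_1) mpoly"
  assumes "\<And>i. i \<in> I \<Longrightarrow> f i \<in> polys X"
  shows "ideal (gen_ideal X f I) (mpoly_ring X)"
proof -
  interpret R: cring "mpoly_ring X :: ('x, 'k) mpoly ring" by (rule cring_mpoly_ring)
  show ?thesis
  proof (rule idealI)
    show "ring (mpoly_ring X :: ('x, 'k) mpoly ring)" by (rule R.ring_axioms)
    have sub: "gen_ideal X f I \<subseteq> polys X" using assms by (rule gen_ideal_in_polys)
    have inv: "inv\<^bsub>add_monoid (mpoly_ring X)\<^esub> p = - p" if "p \<in> polys X" for p :: "('x, 'k) mpoly"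
      using mpoly_ring_uminus [OF that] by (simp add: a_inv_def)
    show "subgroup (gen_ideal X f I) (add_monoid (mpoly_ring X))"
    proof (rule group.subgroupI [OF R.a_group])
      show "gen_ideal X f I \<noteq> {}"
        using gen_ideal_zero [of X f I] by (metis empty_iff)
    qed (use sub inv in \<open>auto simp: carrier_mpoly_ring\<close>)
  qed (auto simp: carrier_mpoly_ring)
qed

lemma genideal_eq_gen_ideal:
  fixes f :: "'i \<Rightarrow> ('x, 'k::comm_ring_1) mpoly"
  assumes "finite I" "\<And>i. i \<in> I \<Longrightarrow> f i \<in> polys X"
  shows "Idl\<^bsub>mpoly_ring X\<^esub> (f ` I) = gen_ideal X f I"
proof
  show "Idl\<^bsub>mpoly_ring X\<^esub> (f ` I) \<subseteq> gen_ideal X f I"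
    unfolding genideal_def using ideal_gen_ideal [OF assms(2)] assms(1) by (intro Inter_lower) auto
  show "gen_ideal X f I \<subseteq> Idl\<^bsub>mpoly_ring X\<^esub> (f ` I)"
    unfolding genideal_def
  proof (rule Inter_greatest, clarify)
    fix J p assume J: "ideal J (mpoly_ring X :: ('x, 'k) mpoly ring)" "f ` I \<subseteq> J" and p: "p \<in> gen_ideal X f I"
    interpret J: ideal J "mpoly_ring X :: ('x, 'k) mpoly ring" by (rule J(1))
    have zero: "0 \<in> J" using additive_subgroup.zero_closed [OF J.is_additive_subgroup] by simp
    have add: "a + b \<in> J" if "a \<in> J" "b \<in> J" for a b
      using additive_subgroup.a_closed [OF J.is_additive_subgroup that] by simp
    have mult: "a * b \<in> J" if "a \<in> polys X" "b \<in> J" for a b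
      using J.I_l_closed [of b a] that by (simp add: carrier_mpoly_ring)
    obtain c where c: "\<And>i. i \<in> I \<Longrightarrow> c i \<in> polys X" "p = (\<Sum>i\<in>I. c i * f i)"
      using p unfolding gen_ideal_def by blast
    have "(\<Sum>i\<in>H. c i * f i) \<in> J" if "H \<subseteq> I" for H
      using that by (induction H rule: infinite_finite_induct) (use zero add mult c(1) J(2) in auto)
    then show "p \<in> J" unfolding c(2) by blast
  qed
qed

lemma primeideal_iff_prime_in:
  fixes f :: "'i \<Rightarrow> ('x, 'k::comm_ring_1) mpoly"
  assumes f: "\<And>i. i \<in> I \<Longrightarrow> f i \<in> polys X"
  shows "primeideal (gen_ideal X f I) (mpoly_ring X) \<longleftrightarrow> prime_in X (gen_ideal X f I)"
proof
  assume P: "primeideal (gen_ideal X f I) (mpoly_ring X)"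
  interpret P: primeideal "gen_ideal X f I" "mpoly_ring X" by (rule P)
  show "prime_in X (gen_ideal X f I)"
    unfolding prime_in_def
  proof (intro conjI ballI impI)
    show "1 \<notin> gen_ideal X f I"
      using P.one_imp_carrier P.I_notcarr by auto
  next
    fix a b assume "a \<in> polys X" "b \<in> polys X" "a * b \<in> gen_ideal X f I"
    then show "a \<in> gen_ideal X f I \<or> b \<in> gen_ideal X f I"
      using P.I_prime [of a b] by (simp add: carrier_mpoly_ring)
  qed
next
  assume P: "prime_in X (gen_ideal X f I)"
  show "primeideal (gen_ideal X f I) (mpoly_ring X)"
  proof (rule primeidealI [OF ideal_gen_ideal [OF f] cring_mpoly_ring])
    show "carrier (mpoly_ring X) \<noteq> gen_ideal X f I"
      using P polys_one [of X] by (auto simp: prime_in_def carrier_mpoly_ring)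
  qed (use prime_inD [OF P] in \<open>auto simp: carrier_mpoly_ring\<close>)
qed

lemma regular_sequence_imp_koszul_acyclic:
  fixes rs :: "('x, 'k::comm_ring_1) mpoly list"
  assumes rs: "regular_sequence (mpoly_ring X) rs"
  shows "koszul_acyclic X ((!) rs) {..<length rs}"
proof -
  have X: "\<And>i. i < length rs \<Longrightarrow> rs ! i \<in> polys X"
    using rs nth_mem unfolding regular_sequence_def carrier_mpoly_ring by blast
  have "koszul_acyclic X ((!) rs) {..<n}" if "n \<le> length rs" for n
    using that
  proof (induction n)
    case 0
    show ?case by (simp add: koszul_acyclic_empty)
  next
    case (Suc n)
    have "set (take n rs) = (!) rs ` {..<n}"
      using Suc.prems by (auto simp: set_conv_nth image_iff) (metis nth_take)+
    then have eq: "Idl\<^bsub>mpoly_ring X\<^esub> (set (take n rs)) = gen_ideal X ((!) rs) {..<n}"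
      using genideal_eq_gen_ideal [of "{..<n}" "(!) rs" X] X Suc.prems by simp
    have "nonzerodivisor_mod X (rs ! n) (gen_ideal X ((!) rs) {..<n})"
      using rs Suc.prems
      unfolding nonzerodivisor_mod_def regular_sequence_def carrier_mpoly_ring mpoly_ring_ops
        Suc_le_eq eq [symmetric]
      by blast
    then show ?case
      unfolding lessThan_Suc using X Suc by (intro koszul_acyclic_insert) auto
  qed
  then show ?thesis by simp
qed

text \<open>
  Every enumeration of the family is a regular sequence, because each initial segment is again
  Koszul acyclic.
\<close>

lemma koszul_acyclic_imp_complete_intersection:
  fixes f :: "'i \<Rightarrow> ('x, 'k::comm_ring_1) mpoly"
  assumes fin: "finite I" and f: "\<And>i. i \<in> I \<Longrightarrow> f i \<in> polys X" "\<And>i. i \<in> I \<Longrightarrow> quadric (f i)"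
    and ac: "koszul_acyclic X f I"
  shows "complete_intersection (gen_ideal X f I) (mpoly_ring X)"
proof -
  obtain es where es: "set es = I" "distinct es"
    using finite_distinct_list [OF fin] by blast
  have idl: "Idl\<^bsub>mpoly_ring X\<^esub> (f ` J) = gen_ideal X f J" if "J \<subseteq> I" for J
    using that fin finite_subset f(1) by (intro genideal_eq_gen_ideal) auto
  have idl_es: "Idl\<^bsub>mpoly_ring X\<^esub> (set (map f es)) = gen_ideal X f I"
    using idl [OF subset_refl] by (simp add: es(1))
  have "regular_sequence (mpoly_ring X) (map f es)"
    unfolding regular_sequence_def
  proof (intro conjI allI impI ballI)
    show "set (map f es) \<subseteq> carrier (mpoly_ring X)"
      using f(1) es(1) by (auto simp: carrier_mpoly_ring)
  next
    fix n a
    assume n: "n < length (map f es)" and a: "a \<in> carrier (mpoly_ring X)"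
      and mem: "map f es ! n \<otimes>\<^bsub>mpoly_ring X\<^esub> a \<in> Idl\<^bsub>mpoly_ring X\<^esub> set (take n (map f es))"
    let ?J = "set (take n es)"
    have J: "?J \<subseteq> I" using set_take_subset es(1) by fastforce
    have eI: "es ! n \<in> I" using n es(1) by auto
    have notin: "es ! n \<notin> ?J"
      using n es(2) by (auto simp: in_set_conv_nth nth_eq_iff_index_eq)
    have eq: "Idl\<^bsub>mpoly_ring X\<^esub> set (take n (map f es)) = gen_ideal X f ?J"
      using idl [OF J] by (simp add: take_map)
    have "koszul_acyclic X f (insert (es ! n) ?J)"
      by (rule koszul_acyclic_subset [OF fin _ f ac]) (use J eI in auto)
    then have nzd: "nonzerodivisor_mod X (f (es ! n)) (gen_ideal X f ?J)"
      by (intro koszul_acyclic_nonzerodivisor [OF _ notin]) simp_all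
    have "f (es ! n) * a \<in> gen_ideal X f ?J"
      using mem n unfolding eq by simp
    moreover have "a \<in> polys X"
      using a by (simp only: carrier_mpoly_ring)
    ultimately show "a \<in> Idl\<^bsub>mpoly_ring X\<^esub> set (take n (map f es))"
      unfolding eq by (rule nonzerodivisor_modD [OF nzd])
  next
    have "(1 :: ('x, 'k) mpoly) \<notin> deg_ge 2"
      by (simp add: deg_ge_def total_deg_def)
    moreover have "gen_ideal X f I \<subseteq> deg_ge 2"
      by (rule gen_ideal_quadrics_subset_deg_ge_2 [OF f(2)])
    ultimately have "1 \<notin> gen_ideal X f I"
      by (metis subsetD)
    then show "Idl\<^bsub>mpoly_ring X\<^esub> set (map f es) \<noteq> carrier (mpoly_ring X)"
      unfolding idl_es carrier_mpoly_ring using polys_one by metis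
  qed
  then show ?thesis
    unfolding complete_intersection_def by (intro exI [of _ "map f es"] conjI idl_es [symmetric])
qed

lemma lss_ideal_eq_gen_ideal:
  fixes k :: "'k::field itself" and V :: "'v set"
  assumes "simple_graph V E"
  shows "lss_ideal k d V E = gen_ideal (V \<times> {1..d}) (edge_poly d) E"
proof -
  have "{lss_poly d i j | i j. {i, j} \<in> E} = (edge_poly d ` E :: ('v \<times> nat, 'k) mpoly set)"
  proof safe
    fix i j assume ij: "{i, j} \<in> E"
    then have "card {i, j} = 2" using assms by (auto simp: simple_graph_def)
    then have "i \<noteq> j" by auto
    then have "lss_poly d i j = (edge_poly d {i, j} :: ('v \<times> nat, 'k) mpoly)"
      by (simp add: lss_poly_def edge_poly_doubleton)
    then show "(lss_poly d i j :: ('v \<times> nat, 'k) mpoly) \<in> edge_poly d ` E"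
      using ij by blast
  next
    fix e assume e: "e \<in> E"
    then obtain i j where "e = {i, j}" "i \<noteq> j"
      using assms by (auto simp: simple_graph_def card_2_iff)
    then show "\<exists>i j. (edge_poly d e :: ('v \<times> nat, 'k) mpoly) = lss_poly d i j \<and> {i, j} \<in> E"
      using e by (auto simp: lss_poly_def edge_poly_doubleton)
  qed
  moreover have "finite E"
    by (rule simple_graph_finite_edges [OF assms])
  moreover have "edge_poly d e \<in> (polys (V \<times> {1..d}) :: ('v \<times> nat, 'k) mpoly set)" if "e \<in> E" for e
    using assms that by (intro edge_poly_in_polys) (simp add: simple_graph_def)
  ultimately show ?thesis
    unfolding lss_ideal_def lss_ring_def by (simp only: genideal_eq_gen_ideal)
qed

text \<open>
  The regular sequence that witnesses a complete intersection may consist of arbitrary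
  inhomogeneous generators, whence the change of generators.
\<close>

lemma complete_intersection_imp_koszul_acyclic:
  assumes G: "lss_graph V E d"
    and ci: "complete_intersection (gen_ideal (V \<times> {1..d}) (edge_poly d) E :: ('v \<times> nat, 'k::field) mpoly set)
      (mpoly_ring (V \<times> {1..d}))"
  shows "koszul_acyclic (V \<times> {1..d}) (edge_poly d :: _ \<Rightarrow> ('v \<times> nat, 'k) mpoly) E"
proof -
  interpret lss_graph V E d "V \<times> {1..d}" by (rule G) simp
  let ?X = "V \<times> {1..d}"
  let ?f = "edge_poly d :: _ \<Rightarrow> ('v \<times> nat, 'k) mpoly"
  obtain rs where rs: "regular_sequence (mpoly_ring ?X) rs" "gen_ideal ?X ?f E = Idl\<^bsub>mpoly_ring ?X\<^esub> (set rs)"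
    using ci unfolding complete_intersection_def by blast
  have rX: "\<And>i. i < length rs \<Longrightarrow> rs ! i \<in> polys ?X"
    using rs(1) nth_mem unfolding regular_sequence_def carrier_mpoly_ring by blast
  have "set rs = (!) rs ` {..<length rs}"
    by (auto simp: set_conv_nth)
  then have eq: "gen_ideal ?X ?f E = gen_ideal ?X ((!) rs) {..<length rs}"
    using rs(2) genideal_eq_gen_ideal [of "{..<length rs}" "(!) rs" ?X] rX by simp
  show ?thesis
  proof (rule koszul_acyclic_change_generators [OF finite_E finite_lessThan])
    show "koszul_acyclic ?X ((!) rs) {..<length rs}"
      by (rule regular_sequence_imp_koszul_acyclic [OF rs(1)])
    show "?f e \<in> gen_ideal ?X ((!) rs) {..<length rs}" if "e \<in> E" for e
      unfolding eq [symmetric] by (rule gen_ideal_base [OF finite_E that])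
    show "rs ! i \<in> gen_ideal ?X ?f E" if "i \<in> {..<length rs}" for i
      unfolding eq by (rule gen_ideal_base [OF finite_lessThan that])
  qed (assumption | rule edge_poly_X quadric_edge_poly edge(2) edge_poly_syzygy_deg_ge_1 [OF G])+
qed

theorem corollary1p2:
  fixes k :: "'k::field itself" and n d :: nat and E :: "nat set set"
  assumes "d \<ge> 1" and "simple_graph {1..n} E"
  shows
    "(primeideal (lss_ideal k d {1..n} E) (lss_ring k d {1..n}) \<longrightarrow>
      primeideal (lss_ideal k (d + 1) {1..n} E) (lss_ring k (d + 1) {1..n})) \<and>
     (complete_intersection (lss_ideal k d {1..n} E) (lss_ring k d {1..n}) \<longrightarrow>
      complete_intersection (lss_ideal k (d + 1) {1..n} E) (lss_ring k (d + 1) {1..n})) \<and>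
     (\<forall>V' E'. subgraph V' E' {1..n} E \<longrightarrow>
       (primeideal (lss_ideal k d {1..n} E) (lss_ring k d {1..n}) \<longrightarrow>
        primeideal (lss_ideal k d V' E') (lss_ring k d V')) \<and>
       (complete_intersection (lss_ideal k d {1..n} E) (lss_ring k d {1..n}) \<longrightarrow>
        complete_intersection (lss_ideal k d V' E') (lss_ring k d V')))"
proof -
  let ?X = "\<lambda>V d. V \<times> {1..d}"
  let ?f = "edge_poly :: nat \<Rightarrow> nat set \<Rightarrow> (nat \<times> nat, 'k) mpoly"
  let ?prime = "\<lambda>V E d. prime_in (?X V d) (gen_ideal (?X V d) (?f d) E)"
  let ?koszul = "\<lambda>V E d. koszul_acyclic (?X V d) (?f d) E"
  have G: "lss_graph {1..n} E d" using assms by (simp add: lss_graph_def)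
  have edges: "?f d e \<in> polys (?X V d)" "quadric (?f d e)"
    if "simple_graph V E" "e \<in> E" for V :: "nat set" and E d e
    using that by (auto simp: simple_graph_def simp del: One_nat_def
        intro!: edge_poly_in_polys quadric_edge_poly)
  have prime: "primeideal (lss_ideal k d V E) (lss_ring k d V) \<longleftrightarrow> ?prime V E d"
    if "simple_graph V E" for V E d
    unfolding lss_ideal_eq_gen_ideal [OF that] lss_ring_def
    by (rule primeideal_iff_prime_in) (rule edges(1) [OF that])
  have ci: "complete_intersection (lss_ideal k d V E) (lss_ring k d V)"
    if "simple_graph V E" "?koszul V E d" for V E d
    unfolding lss_ideal_eq_gen_ideal [OF that(1)] lss_ring_def
    by (rule koszul_acyclic_imp_complete_intersection [OF simple_graph_finite_edges [OF that(1)] edges(1,2) [OF that(1)] that(2)])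
  have koszul: "?koszul {1..n} E d" if "complete_intersection (lss_ideal k d {1..n} E) (lss_ring k d {1..n})"
    using that unfolding lss_ideal_eq_gen_ideal [OF assms(2)] lss_ring_def
    by (rule complete_intersection_imp_koszul_acyclic [OF G])
  have koszul': "?koszul {1..n} E d" if "?prime {1..n} E d"
    by (rule prime_imp_koszul_acyclic [OF G that])
  have 1: "primeideal (lss_ideal k (d + 1) {1..n} E) (lss_ring k (d + 1) {1..n})"
    if "primeideal (lss_ideal k d {1..n} E) (lss_ring k d {1..n})"
    using that increase_dimension(2) [OF assms(2) koszul']
    unfolding prime [OF assms(2)] Suc_eq_plus1 by blast
  have 2: "complete_intersection (lss_ideal k (d + 1) {1..n} E) (lss_ring k (d + 1) {1..n})"
    if "complete_intersection (lss_ideal k d {1..n} E) (lss_ring k d {1..n})"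
    using increase_dimension(1) [OF assms(2) koszul [OF that]]
    unfolding Suc_eq_plus1 by (rule ci [OF assms(2)])
  have 3: "primeideal (lss_ideal k d V' E') (lss_ring k d V')"
    if "subgraph V' E' {1..n} E" "primeideal (lss_ideal k d {1..n} E) (lss_ring k d {1..n})" for V' E'
  proof -
    have sub: "simple_graph V' E'" "?X V' d \<subseteq> ?X {1..n} d" "E' \<subseteq> E"
      using that(1) by (auto simp: subgraph_def)
    have "prime_in (?X {1..n} d) (gen_ideal (?X {1..n} d) (?f d) E')"
      using prime_imp_prime_subgraph [OF G sub(3)] that(2) by (simp only: prime [OF assms(2)])
    then show ?thesis
      unfolding prime [OF sub(1)] by (intro prime_in_restrict [OF sub(2) edges(1) [OF sub(1)]])
  qed
  have 4: "complete_intersection (lss_ideal k d V' E') (lss_ring k d V')"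
    if "subgraph V' E' {1..n} E" "complete_intersection (lss_ideal k d {1..n} E) (lss_ring k d {1..n})" for V' E'
  proof -
    have sub: "simple_graph V' E'" "?X V' d \<subseteq> ?X {1..n} d" "E' \<subseteq> E"
      using that(1) by (auto simp: subgraph_def)
    have "koszul_acyclic (?X {1..n} d) (?f d) E'"
      by (rule koszul_acyclic_subset [OF simple_graph_finite_edges [OF assms(2)] sub(3) edges(1,2) [OF assms(2)] koszul [OF that(2)]])
    then have "?koszul V' E' d"
      by (intro koszul_acyclic_restrict [OF sub(2) edges(1) [OF sub(1)]])
    then show ?thesis by (rule ci [OF sub(1)])
  qed
  show ?thesis using 1 2 3 4 by blast
qed

end
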